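(* Let $X_P=G^{\mathbb C}/P$ be a rational homogeneous variety, and let $\omega(t)$ be any homogeneous (i.e. $G$-invariant for every $t$) solution of the Kähler-Ricci flow $\frac{\partial}{\partial t}\omega(t)=-\mathrm{Ric}(\omega(t))$, $\omega(0)=\omega_0$, on $X_P$ on the maximal time interval $[0,T)$. If $T<\infty$, then there is a constant $C$ such that $$\mathrm{diam}(X_P,\omega(t))\le C\qquad\text{for all }t\in[0,T).$$
   Context: $G^{\mathbb C}$ is a connected, simply connected complex simple Lie group, $P\subset G^{\mathbb C}$ a parabolic subgroup, and $G\subset G^{\mathbb C}$ a fixed compact real form, so that $X_P=G^{\mathbb C}/P=G/G\cap P$ is a homogeneous $G$-space. Kähler metrics are identified with their Kähler forms; $\mathrm{Ric}(\omega)$ is the Ricci form, representing $2\pi c_1(X_P)$; $\mathrm{diam}(X_P,\omega)$ is the diameter of the associated Riemannian metric $\omega(\cdot,J\cdot)$. *)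

theory Defs
  imports "HOL-Analysis.Analysis" "HOL-Algebra.Left_Coset" "HOL-Algebra.Solvable_Groups"
begin

section \<open>Smooth and holomorphic maps in several variables\<close>

fun Ck_on :: "nat \<Rightarrow> 'a::euclidean_space set \<Rightarrow> ('a \<Rightarrow> 'b::real_normed_vector) \<Rightarrow> bool" where
  "Ck_on 0 W f \<longleftrightarrow> continuous_on W f"
| "Ck_on (Suc k) W f \<longleftrightarrow>
     (\<forall>x\<in>W. f differentiable (at x)) \<and> (\<forall>v. Ck_on k W (\<lambda>x. frechet_derivative f (at x) v))"

text \<open>\<^const>\<open>Ck_on\<close> is meant for open sets. On an arbitrary set, such as a product of a half-open
  time interval with an open set, smoothness means the local existence of smooth extensions.\<close>

definition smooth_on :: "'a::euclidean_space set \<Rightarrow> ('a \<Rightarrow> 'b::real_normed_vector) \<Rightarrow> bool" where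
  "smooth_on S f \<longleftrightarrow>
     (\<forall>x\<in>S. \<exists>W h. open W \<and> x \<in> W \<and> (\<forall>k. Ck_on k W h) \<and> (\<forall>y\<in>S \<inter> W. h y = f y))"

text \<open>Complex differentiability: the real Frechet derivative intertwines multiplication by
  \<open>\<i>\<close>. The parameter \<open>J\<close> is multiplication by \<open>\<i>\<close> on the source, which is
  \<open>\<complex>\<^sup>n\<close> or, for group multiplication, \<open>\<complex>\<^sup>n \<times> \<complex>\<^sup>n\<close>.\<close>

definition complex_differentiable_at ::
    "('a \<Rightarrow> 'a) \<Rightarrow> ('a::euclidean_space \<Rightarrow> complex ^ 'n) \<Rightarrow> 'a \<Rightarrow> bool" where
  "complex_differentiable_at J f z \<longleftrightarrow>
     (\<exists>D. (f has_derivative D) (at z) \<and> (\<forall>v. D (J v) = \<i> *s D v))"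


section \<open>Complex manifolds\<close>

type_synonym ('a, 'n) chart = "'a set \<times> ('a \<Rightarrow> complex ^ 'n)"

record ('a, 'n) cmanifold =
  space_top :: "'a topology"
  charts :: "('a, 'n::finite) chart set"

abbreviation chart_dom :: "('a, 'n::finite) chart \<Rightarrow> 'a set" where
  "chart_dom c \<equiv> fst c"

abbreviation chart_map :: "('a, 'n::finite) chart \<Rightarrow> 'a \<Rightarrow> complex ^ 'n" where
  "chart_map c \<equiv> snd c"

abbreviation chart_image :: "('a, 'n::finite) chart \<Rightarrow> (complex ^ 'n) set" where
  "chart_image c \<equiv> snd c ` fst c"

abbreviation chart_inv :: "('a, 'n::finite) chart \<Rightarrow> complex ^ 'n \<Rightarrow> 'a" where
  "chart_inv c \<equiv> inv_into (fst c) (snd c)"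

definition local_rep ::
    "('a, 'm::finite) chart \<Rightarrow> ('b, 'n::finite) chart \<Rightarrow> ('a \<Rightarrow> 'b) \<Rightarrow> complex ^ 'm \<Rightarrow> complex ^ 'n" where
  "local_rep c d f = chart_map d \<circ> f \<circ> chart_inv c"

definition holomorphic_map_on ::
    "('a, 'm::finite) cmanifold \<Rightarrow> ('b, 'n::finite) cmanifold \<Rightarrow> 'a set \<Rightarrow> ('a \<Rightarrow> 'b) \<Rightarrow> bool" where
  "holomorphic_map_on M N V f \<longleftrightarrow>
     openin (space_top M) V \<and>
     continuous_map (subtopology (space_top M) V) (space_top N) f \<and>
     (\<forall>c\<in>charts M. \<forall>d\<in>charts N. \<forall>x\<in>V \<inter> chart_dom c. f x \<in> chart_dom d \<longrightarrow>
        complex_differentiable_at (\<lambda>v. \<i> *s v) (local_rep c d f) (chart_map c x))"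

definition complex_manifold :: "('a, 'n::finite) cmanifold \<Rightarrow> bool" where
  "complex_manifold M \<longleftrightarrow>
     Hausdorff_space (space_top M) \<and> second_countable (space_top M) \<and>
     (\<Union>c\<in>charts M. chart_dom c) = topspace (space_top M) \<and>
     (\<forall>c\<in>charts M. openin (space_top M) (chart_dom c) \<and> open (chart_image c) \<and>
        homeomorphic_map (subtopology (space_top M) (chart_dom c)) (top_of_set (chart_image c))
          (chart_map c)) \<and>
     (\<forall>c\<in>charts M. \<forall>d\<in>charts M. \<forall>x\<in>chart_dom c \<inter> chart_dom d.
        complex_differentiable_at (\<lambda>v. \<i> *s v) (local_rep c d id) (chart_map c x))"


section \<open>Complex Lie groups and their subgroups\<close>

definition complex_lie_group :: "'g monoid \<Rightarrow> ('g, 'm::finite) cmanifold \<Rightarrow> bool" where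
  "complex_lie_group GC M \<longleftrightarrow>
     group GC \<and> complex_manifold M \<and> topspace (space_top M) = carrier GC \<and>
     continuous_map (prod_topology (space_top M) (space_top M)) (space_top M)
       (\<lambda>(a, b). a \<otimes>\<^bsub>GC\<^esub> b) \<and>
     (\<forall>c\<in>charts M. \<forall>d\<in>charts M. \<forall>e\<in>charts M. \<forall>a\<in>chart_dom c. \<forall>b\<in>chart_dom d.
        a \<otimes>\<^bsub>GC\<^esub> b \<in> chart_dom e \<longrightarrow>
        complex_differentiable_at (\<lambda>(v, w). (\<i> *s v, \<i> *s w))
          (\<lambda>(z, w). chart_map e (chart_inv c z \<otimes>\<^bsub>GC\<^esub> chart_inv d w))
          (chart_map c a, chart_map d b)) \<and>
     holomorphic_map_on M M (carrier GC) (\<lambda>a. inv\<^bsub>GC\<^esub> a)"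

text \<open>The analogue of \<^const>\<open>simply_connected\<close> for abstract topologies: the space is path connected
  and any two loops are homotopic through loops.\<close>

definition simply_connected_space :: "'a topology \<Rightarrow> bool" where
  "simply_connected_space X \<longleftrightarrow>
     path_connected_space X \<and>
     (\<forall>p q. pathin X p \<and> p 1 = p 0 \<and> pathin X q \<and> q 1 = q 0 \<longrightarrow>
        homotopic_with (\<lambda>r. r 1 = r 0) (top_of_set {0..1::real}) X p q)"

text \<open>A connected complex Lie group is simple if it is non-abelian and has no closed connected normal
  subgroups besides the trivial ones; this means that its Lie algebra is simple (the centre may
  be a nontrivial discrete subgroup).\<close>

definition simple_complex_lie_group :: "'g monoid \<Rightarrow> ('g, 'm::finite) cmanifold \<Rightarrow> bool" where
  "simple_complex_lie_group GC M \<longleftrightarrow>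
     complex_lie_group GC M \<and> connected_space (space_top M) \<and> \<not> comm_group GC \<and>
     (\<forall>N. N \<lhd> GC \<and> closedin (space_top M) N \<and> connectedin (space_top M) N \<longrightarrow>
        N = {\<one>\<^bsub>GC\<^esub>} \<or> N = carrier GC)"

definition connected_solvable_subgroup ::
    "'g monoid \<Rightarrow> ('g, 'm::finite) cmanifold \<Rightarrow> 'g set \<Rightarrow> bool" where
  "connected_solvable_subgroup GC M B \<longleftrightarrow>
     subgroup B GC \<and> closedin (space_top M) B \<and> connectedin (space_top M) B \<and>
     solvable (GC\<lparr>carrier := B\<rparr>)"

definition borel_subgroup :: "'g monoid \<Rightarrow> ('g, 'm::finite) cmanifold \<Rightarrow> 'g set \<Rightarrow> bool" where
  "borel_subgroup GC M B \<longleftrightarrow>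
     connected_solvable_subgroup GC M B \<and>
     (\<forall>B'. connected_solvable_subgroup GC M B' \<and> B \<subseteq> B' \<longrightarrow> B' = B)"

definition parabolic_subgroup :: "'g monoid \<Rightarrow> ('g, 'm::finite) cmanifold \<Rightarrow> 'g set \<Rightarrow> bool" where
  "parabolic_subgroup GC M P \<longleftrightarrow>
     subgroup P GC \<and> closedin (space_top M) P \<and> (\<exists>B. borel_subgroup GC M B \<and> B \<subseteq> P)"

text \<open>The Lie algebra of a closed subgroup \<open>H\<close>, as the set of initial velocities of the one-parameter
  subgroups contained in \<open>H\<close>; the tangent space of the ambient group at the identity is
  identified with \<open>\<complex>\<^sup>m\<close> by a chart \<open>c\<close> around the identity.\<close>

definition lie_algebra_in_chart ::
    "'g monoid \<Rightarrow> ('g, 'm::finite) cmanifold \<Rightarrow> ('g, 'm) chart \<Rightarrow> 'g set \<Rightarrow> (complex ^ 'm) set" where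
  "lie_algebra_in_chart GC M c H =
     {v. \<exists>\<gamma>::real \<Rightarrow> 'g. continuous_map euclideanreal (space_top M) \<gamma> \<and> range \<gamma> \<subseteq> H \<and>
        (\<forall>s t. \<gamma> (s + t) = \<gamma> s \<otimes>\<^bsub>GC\<^esub> \<gamma> t) \<and>
        ((chart_map c \<circ> \<gamma>) has_vector_derivative v) (at 0)}"

text \<open>A compact real form: a compact subgroup with Lie algebra \<open>\<gg>\<close> such that the Lie algebra of
  the ambient complex group is the direct sum of \<open>\<gg>\<close> and \<open>\<i> \<gg>\<close>.\<close>

definition compact_real_form :: "'g monoid \<Rightarrow> ('g, 'm::finite) cmanifold \<Rightarrow> 'g set \<Rightarrow> bool" where
  "compact_real_form GC M K \<longleftrightarrow>
     subgroup K GC \<and> compactin (space_top M) K \<and>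
     (\<forall>c\<in>charts M. \<one>\<^bsub>GC\<^esub> \<in> chart_dom c \<longrightarrow>
        (\<forall>z. \<exists>!(a, b). a \<in> lie_algebra_in_chart GC M c K \<and>
           b \<in> lie_algebra_in_chart GC M c K \<and> z = a + \<i> *s b))"

text \<open>The quotient complex manifold \<open>GC / P\<close>: the set of left cosets with the quotient topology and
  the unique complex structure for which the projection is holomorphic and has local
  holomorphic sections.\<close>

definition quotient_complex_manifold ::
    "'g monoid \<Rightarrow> ('g, 'm::finite) cmanifold \<Rightarrow> 'g set \<Rightarrow> ('g set, 'n::finite) cmanifold \<Rightarrow> bool" where
  "quotient_complex_manifold GC M P X \<longleftrightarrow>
     complex_manifold X \<and> topspace (space_top X) = lcosets\<^bsub>GC\<^esub> P \<and>
     quotient_map (space_top M) (space_top X) (\<lambda>a. a <#\<^bsub>GC\<^esub> P) \<and>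
     holomorphic_map_on M X (carrier GC) (\<lambda>a. a <#\<^bsub>GC\<^esub> P) \<and>
     (\<forall>x\<in>topspace (space_top X). \<exists>V s. x \<in> V \<and> holomorphic_map_on X M V s \<and>
        (\<forall>y\<in>V. s y <#\<^bsub>GC\<^esub> P = y))"


section \<open>Kaehler forms, Ricci forms and diameters\<close>

text \<open>A real two-tensor field is given by its coordinate representations: \<open>\<omega> c z v w\<close> is the value
  in the chart \<open>c\<close>, at the coordinate point \<open>z\<close> of the image of \<open>c\<close>, on the coordinate vectors \<open>v\<close> and
  \<open>w\<close>. Values for charts outside the atlas or points outside the image are irrelevant.
  The field is preserved by \<open>f\<close> if the pullback of \<open>\<omega>\<close> by \<open>f\<close> is \<open>\<omega>\<close>; for \<open>f = id\<close> this is
  the transformation rule under changes of charts.\<close>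

type_synonym ('a, 'n) tensor2 =
  "('a, 'n) chart \<Rightarrow> complex ^ 'n \<Rightarrow> complex ^ 'n \<Rightarrow> complex ^ 'n \<Rightarrow> real"

definition preserved_by ::
    "('a, 'n::finite) cmanifold \<Rightarrow> ('a \<Rightarrow> 'a) \<Rightarrow> ('a, 'n) tensor2 \<Rightarrow> bool" where
  "preserved_by M f \<omega> \<longleftrightarrow>
     (\<forall>c\<in>charts M. \<forall>d\<in>charts M. \<forall>x\<in>chart_dom c. f x \<in> chart_dom d \<longrightarrow>
        (\<forall>v w. \<omega> c (chart_map c x) v w =
           \<omega> d (chart_map d (f x))
             (frechet_derivative (local_rep c d f) (at (chart_map c x)) v)
             (frechet_derivative (local_rep c d f) (at (chart_map c x)) w)))"

text \<open>Closedness is the vanishing of the exterior derivative on constant coordinate vector fields.\<close>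

definition kaehler_form :: "('a, 'n::finite) cmanifold \<Rightarrow> ('a, 'n) tensor2 \<Rightarrow> bool" where
  "kaehler_form M \<omega> \<longleftrightarrow>
     preserved_by M id \<omega> \<and>
     (\<forall>c\<in>charts M.
        (\<forall>v w. smooth_on (chart_image c) (\<lambda>z. \<omega> c z v w)) \<and>
        (\<forall>z\<in>chart_image c.
           bilinear (\<omega> c z) \<and>
           (\<forall>v w. \<omega> c z w v = - \<omega> c z v w) \<and>
           (\<forall>v w. \<omega> c z (\<i> *s v) (\<i> *s w) = \<omega> c z v w) \<and>
           (\<forall>v. v \<noteq> 0 \<longrightarrow> \<omega> c z v (\<i> *s v) > 0) \<and>
           (\<forall>u v w. frechet_derivative (\<lambda>y. \<omega> c y v w) (at z) u
                  + frechet_derivative (\<lambda>y. \<omega> c y w u) (at z) v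
                  + frechet_derivative (\<lambda>y. \<omega> c y u v) (at z) w = 0)))"

text \<open>The coefficients \<open>g\<^sub>j\<^sub>k\<close> in \<open>\<omega> = \<i> \<Sum> g\<^sub>j\<^sub>k dz\<^sub>j \<and> d(cnj z\<^sub>k)\<close>.\<close>

definition metric_matrix ::
    "('a, 'n::finite) tensor2 \<Rightarrow> ('a, 'n) chart \<Rightarrow> complex ^ 'n \<Rightarrow> complex ^ 'n ^ 'n" where
  "metric_matrix \<omega> c z =
     (\<chi> j k. (of_real (\<omega> c z (axis j 1) (axis k \<i>))
             - \<i> * of_real (\<omega> c z (axis j 1) (axis k 1))) / 2)"

definition wirtinger :: "'n::finite \<Rightarrow> (complex ^ 'n \<Rightarrow> complex) \<Rightarrow> complex ^ 'n \<Rightarrow> complex" where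
  "wirtinger j f z =
     (frechet_derivative f (at z) (axis j 1) - \<i> * frechet_derivative f (at z) (axis j \<i>)) / 2"

definition wirtinger_bar :: "'n::finite \<Rightarrow> (complex ^ 'n \<Rightarrow> complex) \<Rightarrow> complex ^ 'n \<Rightarrow> complex" where
  "wirtinger_bar j f z =
     (frechet_derivative f (at z) (axis j 1) + \<i> * frechet_derivative f (at z) (axis j \<i>)) / 2"

text \<open>The real form \<open>\<i> \<partial> \<partial>bar F\<close> of a real function \<open>F\<close>; the sum inside \<^const>\<open>Re\<close> is real when
  \<open>F\<close> is of class \<open>C\<^sup>2\<close>.\<close>

definition i_ddbar ::
    "(complex ^ 'n::finite \<Rightarrow> real) \<Rightarrow> complex ^ 'n \<Rightarrow> complex ^ 'n \<Rightarrow> complex ^ 'n \<Rightarrow> real" where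
  "i_ddbar F z v w =
     Re (\<i> * (\<Sum>j\<in>UNIV. \<Sum>k\<in>UNIV. wirtinger j (wirtinger_bar k (\<lambda>y. of_real (F y))) z
                * (v $ j * cnj (w $ k) - w $ j * cnj (v $ k))))"

text \<open>\<open>Ric(\<omega>) = - \<i> \<partial> \<partial>bar log det g\<close>, which represents \<open>2 \<pi> c\<^sub>1\<close>. For a Kaehler form the determinant
  is a positive real number.\<close>

definition ricci_form :: "('a, 'n::finite) tensor2 \<Rightarrow> ('a, 'n) tensor2" where
  "ricci_form \<omega> = (\<lambda>c z v w. - i_ddbar (\<lambda>y. ln (Re (det (metric_matrix \<omega> c y)))) z v w)"

definition piecewise_C1_curve :: "('a, 'n::finite) cmanifold \<Rightarrow> (real \<Rightarrow> 'a) \<Rightarrow> bool" where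
  "piecewise_C1_curve M \<gamma> \<longleftrightarrow>
     pathin (space_top M) \<gamma> \<and>
     (\<exists>S. finite S \<and> (\<forall>c\<in>charts M.
        (chart_map c \<circ> \<gamma>) C1_differentiable_on {t \<in> {0..1} - S. \<gamma> t \<in> chart_dom c}))"

text \<open>The norm of the velocity for the Riemannian metric \<open>\<omega>(v, J v)\<close>; when \<open>\<omega>\<close> satisfies the
  transformation rule, it does not depend on the chosen chart.\<close>

definition speed ::
    "('a, 'n::finite) cmanifold \<Rightarrow> ('a, 'n) tensor2 \<Rightarrow> (real \<Rightarrow> 'a) \<Rightarrow> real \<Rightarrow> real" where
  "speed M \<omega> \<gamma> t =
     (let c = (SOME c. c \<in> charts M \<and> \<gamma> t \<in> chart_dom c);
          v = vector_derivative (chart_map c \<circ> \<gamma>) (at t)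
      in sqrt (\<omega> c (chart_map c (\<gamma> t)) v (\<i> *s v)))"

text \<open>The length is a nonnegative Lebesgue integral, so that a curve whose speed is not integrable has
  infinite length. Distances and diameters are extended nonnegative reals.\<close>

definition curve_length ::
    "('a, 'n::finite) cmanifold \<Rightarrow> ('a, 'n) tensor2 \<Rightarrow> (real \<Rightarrow> 'a) \<Rightarrow> ennreal" where
  "curve_length M \<omega> \<gamma> = (\<integral>\<^sup>+ t \<in> {0..1}. ennreal (speed M \<omega> \<gamma> t) \<partial>lborel)"

definition riemannian_dist ::
    "('a, 'n::finite) cmanifold \<Rightarrow> ('a, 'n) tensor2 \<Rightarrow> 'a \<Rightarrow> 'a \<Rightarrow> ennreal" where
  "riemannian_dist M \<omega> x y =
     (INF \<gamma> \<in> {\<gamma>. piecewise_C1_curve M \<gamma> \<and> \<gamma> 0 = x \<and> \<gamma> 1 = y}. curve_length M \<omega> \<gamma>)"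

definition riemannian_diam :: "('a, 'n::finite) cmanifold \<Rightarrow> ('a, 'n) tensor2 \<Rightarrow> ennreal" where
  "riemannian_diam M \<omega> =
     (SUP x \<in> topspace (space_top M). SUP y \<in> topspace (space_top M). riemannian_dist M \<omega> x y)"


section \<open>The Kaehler-Ricci flow\<close>

definition time_interval :: "ereal \<Rightarrow> real set" where
  "time_interval T = {t. 0 \<le> t \<and> ereal t < T}"

definition kaehler_ricci_flow ::
    "('a, 'n::finite) cmanifold \<Rightarrow> ereal \<Rightarrow> ('a, 'n) tensor2 \<Rightarrow> (real \<Rightarrow> ('a, 'n) tensor2) \<Rightarrow> bool" where
  "kaehler_ricci_flow M T \<omega>0 \<omega> \<longleftrightarrow>
     0 < T \<and> \<omega> 0 = \<omega>0 \<and>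
     (\<forall>t\<in>time_interval T. kaehler_form M (\<omega> t)) \<and>
     (\<forall>c\<in>charts M. \<forall>v w. smooth_on (time_interval T \<times> chart_image c) (\<lambda>(t, z). \<omega> t c z v w)) \<and>
     (\<forall>t\<in>time_interval T. \<forall>c\<in>charts M. \<forall>z\<in>chart_image c. \<forall>v w.
        ((\<lambda>s. \<omega> s c z v w) has_real_derivative - ricci_form (\<omega> t) c z v w)
          (at t within time_interval T))"

definition maximal_kaehler_ricci_flow ::
    "('a, 'n::finite) cmanifold \<Rightarrow> ereal \<Rightarrow> ('a, 'n) tensor2 \<Rightarrow> (real \<Rightarrow> ('a, 'n) tensor2) \<Rightarrow> bool" where
  "maximal_kaehler_ricci_flow M T \<omega>0 \<omega> \<longleftrightarrow>
     kaehler_ricci_flow M T \<omega>0 \<omega> \<and>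
     (\<nexists>T' \<omega>'. T < T' \<and> kaehler_ricci_flow M T' \<omega>0 \<omega>' \<and> (\<forall>t\<in>time_interval T. \<omega>' t = \<omega> t))"

end

theory Submission
  imports Defs "HOL-Complex_Analysis.Cauchy_Integral_Formula"
begin

text \<open>The quotient of the volume densities of two invariant Kaehler forms is an invariant function, hence
  constant, so all invariant Kaehler forms have the same Ricci form. The flow is therefore
  \<open>\<omega>(t) = \<omega>\<^sub>0 - t Ric(\<omega>\<^sub>0)\<close>. At one point this is at most \<open>K \<omega>\<^sub>0\<close> for all \<open>t < T\<close>, since \<open>T\<close> is finite, and
  by transitivity the same \<open>K\<close> works everywhere. So a curve grows in length by a factor of at most
  \<open>sqrt K\<close>, and the diameter of the compact connected space is finite at time \<open>0\<close>.\<close>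

section \<open>Positive invariant forms on complex vector spaces\<close>

text \<open>The quotient of volume densities is constant because a holomorphic transformation moving
  y to z has a complex linear differential D there, and pulling back by D multiplies the Gram
  determinant of every invariant form by the same factor |det D|^2. The bound for all t rests on a
  comparison at the single time T/2. Neither invariance nor bilinearity of the Ricci form is
  established, so it is not estimated directly; but \<omega>(T/2) is itself an invariant Kaehler
  form, hence dominated by the initial one, and the affine dependence on t turns this into an upper
  bound for -Ric and then for every time. Two obstacles shape the analysis. Holomorphy is given as
  complex differentiability at each point, while admissible curves need continuous derivatives. And
  finiteness of the initial diameter needs actual curves; these are built with a bound on the
  squared speed, a pointwise quantity that is carried to later times by the comparison of
  forms.\<close>

lemma scaleR_eq_complex_smult: "r *\<^sub>R v = of_real r *s (v :: complex ^ 'n)"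
  by (simp add: vec_eq_iff complex_eq_iff)

lemma complex_smult_split: "a *s v = Re a *\<^sub>R v + Im a *\<^sub>R (\<i> *s (v :: complex ^ 'n))"
  by (simp add: vec_eq_iff complex_eq_iff)

lemma vec_eq_sum_axis: "v = (\<Sum>j\<in>UNIV. v $ j *s axis j (1 :: complex))"
  for v :: "complex ^ 'n::finite"
  by (simp add: vec_eq_iff axis_def if_distrib sum.delta' cong: if_cong)

lemma continuous_on_complex_smult [continuous_intros]:
  "continuous_on A f \<Longrightarrow> continuous_on A (\<lambda>x. a *s (f x :: complex ^ 'n))"
  unfolding vector_scalar_mult_def by (intro continuous_intros)

locale positive_form =
  fixes b :: "complex ^ 'n::finite \<Rightarrow> complex ^ 'n \<Rightarrow> real"
  assumes bilinear: "bilinear b"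
    and alternating: "b w v = - b v w"
    and invariant: "b (\<i> *s v) (\<i> *s w) = b v w"
    and positive: "v \<noteq> 0 \<Longrightarrow> b v (\<i> *s v) > 0"

text \<open>The Hermitian form, complex linear in the first argument and conjugate linear in the
  second, whose real part is half the Riemannian metric. The factor 1/2 matches the normalisation of
  \<open>metric_matrix\<close>.\<close>

definition hermitian_part ::
    "(complex ^ 'n::finite \<Rightarrow> complex ^ 'n \<Rightarrow> real) \<Rightarrow> complex ^ 'n \<Rightarrow> complex ^ 'n \<Rightarrow> complex" where
  "hermitian_part b v w = (of_real (b v (\<i> *s w)) - \<i> * of_real (b v w)) / 2"

definition gram_matrix ::
    "(complex ^ 'n::finite \<Rightarrow> complex ^ 'n \<Rightarrow> real) \<Rightarrow> complex ^ 'n ^ 'n" where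
  "gram_matrix b = (\<chi> j k. hermitian_part b (axis j 1) (axis k 1))"

lemma smult_i_axis: "\<i> *s axis k 1 = axis k \<i>"
  by (simp add: vec_eq_iff axis_def)

lemma metric_matrix_eq_gram: "metric_matrix \<omega> c z = gram_matrix (\<omega> c z)"
  by (simp add: metric_matrix_def gram_matrix_def hermitian_part_def smult_i_axis)

section \<open>The Hermitian form at one point: Gram determinant, pullback, comparison\<close>

context positive_form
begin

lemma hermitian_part_add_left: "hermitian_part b (u + v) w = hermitian_part b u w + hermitian_part b v w"
  by (simp add: hermitian_part_def bilinear_ladd[OF bilinear] field_simps)

lemma hermitian_part_scaleR_left: "hermitian_part b (r *\<^sub>R v) w = of_real r * hermitian_part b v w"
  by (simp add: hermitian_part_def bilinear_lmul[OF bilinear] field_simps)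

lemma form_i_left: "b (\<i> *s v) w = - b v (\<i> *s w)"
proof -
  have "\<i> *s (\<i> *s w) = - w"
    by (simp add: vec_eq_iff)
  then have "b (\<i> *s v) (- w) = b v (\<i> *s w)"
    using invariant[of v "\<i> *s w"] by simp
  then show ?thesis
    using bilinear_rneg[OF bilinear, of "\<i> *s v" w] by simp
qed

lemma hermitian_part_i_left: "hermitian_part b (\<i> *s v) w = \<i> * hermitian_part b v w"
  by (simp add: hermitian_part_def form_i_left[of v w] invariant[of v w] field_simps del: vector_smult_assoc)

lemma hermitian_part_cnj: "hermitian_part b w v = cnj (hermitian_part b v w)"
  using form_i_left[of v w] alternating[of v w] alternating[of "\<i> *s v" w]
  by (simp add: hermitian_part_def)

lemma hermitian_part_smult_left: "hermitian_part b (a *s v) w = a * hermitian_part b v w"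
proof -
  have "hermitian_part b (a *s v) w = (of_real (Re a) + \<i> * of_real (Im a)) * hermitian_part b v w"
    unfolding complex_smult_split[of a]
    by (simp add: hermitian_part_add_left hermitian_part_scaleR_left hermitian_part_i_left algebra_simps)
  then show ?thesis
    by (simp add: complex_eq[symmetric])
qed

lemma hermitian_part_sum_left: "hermitian_part b (\<Sum>i\<in>A. f i) w = (\<Sum>i\<in>A. hermitian_part b (f i) w)"
proof (induction A rule: infinite_finite_induct)
  case empty
  show ?case using hermitian_part_smult_left[of 0 0 w] by simp
next
  case (infinite A)
  then show ?case using hermitian_part_smult_left[of 0 0 w] by simp
qed (simp add: hermitian_part_add_left)

lemma hermitian_part_expand_left:
  "hermitian_part b v w = (\<Sum>j\<in>UNIV. v $ j * hermitian_part b (axis j 1) w)"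
  using arg_cong[OF vec_eq_sum_axis[of v], of "\<lambda>v. hermitian_part b v w"]
  by (simp only: hermitian_part_sum_left hermitian_part_smult_left)

text \<open>Linearity expands the first argument; the second follows by conjugate symmetry, which is
  where the conjugates of the coordinates of \<open>w\<close> come from.\<close>

lemma hermitian_part_expand:
  "hermitian_part b v w = (\<Sum>j\<in>UNIV. v $ j * (\<Sum>k\<in>UNIV. gram_matrix b $ j $ k * cnj (w $ k)))"
proof -
  have "hermitian_part b (axis j 1) w = (\<Sum>k\<in>UNIV. gram_matrix b $ j $ k * cnj (w $ k))" for j
  proof -
    have "hermitian_part b (axis j 1) w = cnj (hermitian_part b w (axis j 1))"
      by (rule hermitian_part_cnj)
    also have "\<dots> = (\<Sum>k\<in>UNIV. cnj (w $ k) * cnj (hermitian_part b (axis k 1) (axis j 1)))"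
      by (subst hermitian_part_expand_left) simp
    also have "\<dots> = (\<Sum>k\<in>UNIV. gram_matrix b $ j $ k * cnj (w $ k))"
      by (simp add: gram_matrix_def hermitian_part_cnj[symmetric] mult.commute)
    finally show ?thesis .
  qed
  then show ?thesis
    by (subst hermitian_part_expand_left) simp
qed

text \<open>The Gram matrix is Hermitian, so its transpose, which has the same determinant, is its
  entrywise conjugate.\<close>

lemma det_gram_matrix_real: "det (gram_matrix b) \<in> \<real>"
proof -
  have "det (gram_matrix b) = det (transpose (gram_matrix b))"
    by simp
  also have "\<dots> = det (\<chi> j k. cnj (gram_matrix b $ j $ k))"
    by (simp add: transpose_def gram_matrix_def hermitian_part_cnj[symmetric])
  also have "\<dots> = cnj (det (gram_matrix b))"
    by (simp add: det_def)
  finally show ?thesis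
    by (simp add: Reals_cnj_iff)
qed

text \<open>A kernel vector of the Gram matrix would produce a nonzero vector of length
  zero.\<close>

lemma det_gram_matrix_nonzero: "det (gram_matrix b) \<noteq> 0"
proof -
  have "u = 0" if "gram_matrix b *v u = 0" for u
  proof (rule ccontr)
    assume "u \<noteq> 0"
    \<comment> \<open>The conjugate is taken because the second argument enters
      \<open>hermitian_part_expand\<close> conjugated: with this \<open>w\<close> the inner sum is
      exactly a coordinate of the Gram matrix applied to \<open>u\<close>.\<close>
    define w where "w = (\<chi> k. cnj (u $ k))"
    have "w \<noteq> 0"
      using \<open>u \<noteq> 0\<close> by (simp add: w_def vec_eq_iff)
    have "hermitian_part b w w = (\<Sum>j\<in>UNIV. w $ j * (gram_matrix b *v u) $ j)"
      by (simp add: hermitian_part_expand w_def matrix_vector_mult_def)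
    then have "hermitian_part b w w = 0"
      using that by simp
    moreover have "Re (hermitian_part b w w) = b w (\<i> *s w) / 2"
      by (simp add: hermitian_part_def)
    ultimately show False
      using positive[OF \<open>w \<noteq> 0\<close>] by simp
  qed
  then show ?thesis
    unfolding invertible_det_nz[symmetric] invertible_left_inverse matrix_left_invertible_ker by blast
qed

lemma Re_det_gram_matrix_nonzero: "Re (det (gram_matrix b)) \<noteq> 0"
  using det_gram_matrix_nonzero det_gram_matrix_real by (auto simp: complex_is_Real_iff complex_eq_iff)

text \<open>Since \<open>D\<close> commutes with \<i>, it also pulls back the Hermitian form. Only
  the vectors \<open>D (axis k 1)\<close>, the columns of \<open>matrix D\<close>, enter, so
  commuting with \<i> is all that is asked of \<open>D\<close>.\<close>

lemma gram_matrix_pullback: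
  assumes "\<And>v w. b' v w = b (D v) (D w)" and "\<And>v. D (\<i> *s v) = \<i> *s D v"
  shows "gram_matrix b' = transpose (matrix D) ** gram_matrix b ** (\<chi> j k. cnj (matrix D $ j $ k))"
proof -
  have "gram_matrix b' $ j $ k = hermitian_part b (D (axis j 1)) (D (axis k 1))" for j k
    by (simp add: gram_matrix_def hermitian_part_def assms)
  then show ?thesis
    unfolding matrix_mul_assoc[symmetric]
    by (simp add: vec_eq_iff hermitian_part_expand matrix_matrix_mult_def transpose_def matrix_def)
qed

text \<open>The factor |det D|^2 depends on \<open>D\<close> alone and not on the form, so it
  cancels when two forms are pulled back by the same map.\<close>

lemma det_gram_matrix_pullback:
  assumes "\<And>v w. b' v w = b (D v) (D w)" and "\<And>v. D (\<i> *s v) = \<i> *s D v"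
  shows "det (gram_matrix b') = det (matrix D) * cnj (det (matrix D)) * det (gram_matrix b)"
proof -
  have "det (\<chi> j k. cnj (matrix D $ j $ k)) = cnj (det (matrix D))"
    by (simp add: det_def)
  then show ?thesis
    by (simp add: gram_matrix_pullback[of b' D, OF assms] det_mul)
qed

text \<open>Both sides are quadratic in \<open>v\<close>, so it suffices to compare on the compact
  unit sphere, where the denominator of the quotient does not vanish and a maximum is
  attained.\<close>

lemma dominates:
  assumes "bilinear b'"
  obtains K where "K \<ge> 0" "\<And>v. b' v (\<i> *s v) \<le> K * b v (\<i> *s v)"
proof -
  have cont: "continuous_on (sphere 0 1) (\<lambda>v. \<beta> v (\<i> *s v))"
    if "bilinear \<beta>" for \<beta> :: "complex ^ 'n \<Rightarrow> complex ^ 'n \<Rightarrow> real"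
    by (rule bounded_bilinear.continuous_on[OF bilinear_conv_bounded_bilinear[THEN iffD1, OF that]])
      (intro continuous_intros)+
  have "sphere 0 1 \<noteq> ({} :: (complex ^ 'n) set)"
    by simp
  moreover have "b v (\<i> *s v) \<noteq> 0" if "v \<in> sphere 0 1" for v
    using positive[of v] that by force
  ultimately obtain u where u: "u \<in> sphere 0 1"
      "\<And>v. v \<in> sphere 0 1 \<Longrightarrow> b' v (\<i> *s v) / b v (\<i> *s v) \<le> b' u (\<i> *s u) / b u (\<i> *s u)"
    using continuous_attains_sup[OF compact_sphere, of 0 1 "\<lambda>v. b' v (\<i> *s v) / b v (\<i> *s v)"]
      continuous_on_divide[OF cont[OF assms] cont[OF bilinear]] by blast
  \<comment> \<open>\<open>b'\<close> is not assumed positive, so the maximum may be negative; later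
    estimates multiply by \<open>K\<close> and need its sign.\<close>
  define K where "K = max 0 (b' u (\<i> *s u) / b u (\<i> *s u))"
  have "b' v (\<i> *s v) \<le> K * b v (\<i> *s v)" for v
  proof (cases "v = 0")
    case True
    then show ?thesis
      by (simp add: bilinear_lzero[OF bilinear] bilinear_lzero[OF assms])
  next
    case False
    define e where "e = v /\<^sub>R norm v"
    have e: "e \<in> sphere 0 1" "v = norm v *\<^sub>R e" "e \<noteq> 0"
      using False by (auto simp: e_def)
    have scale: "\<beta> v (\<i> *s v) = (norm v)\<^sup>2 * \<beta> e (\<i> *s e)"
      if "bilinear \<beta>" for \<beta> :: "complex ^ 'n \<Rightarrow> complex ^ 'n \<Rightarrow> real"
    proof -
      have "\<i> *s v = norm v *\<^sub>R (\<i> *s e)"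
        by (subst e(2)) (simp add: vec_eq_iff)
      then show ?thesis
        by (subst (1) e(2)) (simp add: bilinear_lmul[OF that] bilinear_rmul[OF that] power2_eq_square)
    qed
    have "b' e (\<i> *s e) / b e (\<i> *s e) \<le> K"
      using u(2)[OF e(1)] by (simp add: K_def)
    then have "b' e (\<i> *s e) \<le> K * b e (\<i> *s e)"
      using positive[OF e(3)] by (simp add: field_simps)
    then show ?thesis
      using mult_left_mono[of "b' e (\<i> *s e)" "K * b e (\<i> *s e)" "(norm v)\<^sup>2"]
      by (simp add: scale[OF assms] scale[OF bilinear] mult.left_commute)
  qed
  then show ?thesis
    using that[of K] by (simp add: K_def)
qed

end

section \<open>Complex differentiability\<close>

text \<open>Differentiability is not assumed. Both functions admit exactly the same derivatives, so
  the choice made by \<open>frechet_derivative\<close> agrees even where no derivative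
  exists.\<close>

lemma frechet_derivative_cong_const:
  assumes "open W" "z \<in> W" "\<And>y. y \<in> W \<Longrightarrow> f y = k + g y"
  shows "frechet_derivative f (at z) = frechet_derivative g (at z)"
proof -
  have "(f has_derivative D) (at z) \<longleftrightarrow> (g has_derivative D) (at z)" for D
  proof
    assume "(f has_derivative D) (at z)"
    then have "((\<lambda>y. f y - k) has_derivative D) (at z)"
      by (auto intro!: derivative_eq_intros)
    then show "(g has_derivative D) (at z)"
      by (rule has_derivative_transform_within_open[OF _ assms(1,2)]) (simp add: assms(3))
  next
    assume "(g has_derivative D) (at z)"
    then have "((\<lambda>y. k + g y) has_derivative D) (at z)"
      by (auto intro!: derivative_eq_intros)
    then show "(f has_derivative D) (at z)"
      by (rule has_derivative_transform_within_open[OF _ assms(1,2)]) (simp add: assms(3))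
  qed
  then show ?thesis
    by (simp add: frechet_derivative_def)
qed

text \<open>The inner derivative kills the constant on the whole neighbourhood \<open>W\<close>, so
  the outer one acts on functions that agree near \<open>z\<close>. Regularity of \<open>F\<close>
  never enters.\<close>

lemma i_ddbar_cong_const:
  assumes W: "open W" "z \<in> W" and eq: "\<And>y. y \<in> W \<Longrightarrow> F y = k + F' y"
  shows "i_ddbar F z = i_ddbar F' z"
proof -
  have "wirtinger_bar j (\<lambda>y. complex_of_real (F y)) y = wirtinger_bar j (\<lambda>y. of_real (F' y)) y"
    if "y \<in> W" for j y
    using frechet_derivative_cong_const[OF \<open>open W\<close> that, of "\<lambda>y. complex_of_real (F y)" "of_real k"]
    by (simp add: wirtinger_bar_def eq)
  then have "wirtinger i (wirtinger_bar j (\<lambda>y. complex_of_real (F y))) z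
      = wirtinger i (wirtinger_bar j (\<lambda>y. of_real (F' y))) z" for i j
    using frechet_derivative_cong_const[OF W, of "wirtinger_bar j (\<lambda>y. complex_of_real (F y))" 0
        "wirtinger_bar j (\<lambda>y. of_real (F' y))"]
    by (simp add: wirtinger_def)
  then show ?thesis
    by (simp add: i_ddbar_def fun_eq_iff)
qed

lemma complex_differentiable_at_compose:
  assumes "complex_differentiable_at J f z" "complex_differentiable_at (\<lambda>v. \<i> *s v) g (f z)"
  shows "complex_differentiable_at J (\<lambda>x. g (f x)) z"
proof -
  obtain D D' where "(f has_derivative D) (at z)" "\<And>v. D (J v) = \<i> *s D v"
      "(g has_derivative D') (at (f z))" "\<And>v. D' (\<i> *s v) = \<i> *s D' v"
    using assms unfolding complex_differentiable_at_def by auto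
  then show ?thesis
    unfolding complex_differentiable_at_def
    by (intro exI[of _ "\<lambda>v. D' (D v)"]) (auto intro: has_derivative_compose)
qed

text \<open>Freezing the first factor restricts the derivative to vectors \<open>(0, w)\<close>.
  This extracts left translation by a fixed element from joint differentiability of the group
  multiplication.\<close>

lemma complex_differentiable_at_slice:
  assumes "complex_differentiable_at (\<lambda>(v, w). (\<i> *s v, \<i> *s w)) F (p, q)"
  shows "complex_differentiable_at (\<lambda>v. \<i> *s v) (\<lambda>w. F (p, w)) q"
proof -
  obtain D where D: "(F has_derivative D) (at (p, q))" "\<And>v w. D (\<i> *s v, \<i> *s w) = \<i> *s D (v, w)"
    using assms unfolding complex_differentiable_at_def by auto
  have "((\<lambda>w. (p, w)) has_derivative (\<lambda>w. (0, w))) (at q)"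
    by (auto intro!: derivative_eq_intros)
  from has_derivative_compose[OF this D(1)] show ?thesis
    unfolding complex_differentiable_at_def using D(2)[of 0]
    by (intro exI[of _ "\<lambda>w. D (0, w)"]) simp
qed

lemma complex_differentiable_at_transform:
  assumes "complex_differentiable_at J f z" "open W" "z \<in> W" "\<And>y. y \<in> W \<Longrightarrow> f y = g y"
  shows "complex_differentiable_at J g z"
proof -
  obtain D where "(f has_derivative D) (at z)" "\<And>v. D (J v) = \<i> *s D v"
    using assms(1) unfolding complex_differentiable_at_def by blast
  moreover from this(1) have "(g has_derivative D) (at z)"
    by (rule has_derivative_transform_within_open[OF _ assms(2,3)]) (simp add: assms(4))
  ultimately show ?thesis
    unfolding complex_differentiable_at_def by blast
qed

lemma complex_differentiable_at_frechet_derivative: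
  assumes "complex_differentiable_at J f z"
  shows "(f has_derivative frechet_derivative f (at z)) (at z)"
    and "frechet_derivative f (at z) (J v) = \<i> *s frechet_derivative f (at z) v"
proof -
  obtain D where "(f has_derivative D) (at z)" "\<And>v. D (J v) = \<i> *s D v"
    using assms unfolding complex_differentiable_at_def by blast
  then show "(f has_derivative frechet_derivative f (at z)) (at z)"
    and "frechet_derivative f (at z) (J v) = \<i> *s frechet_derivative f (at z) v"
    using frechet_derivative_at[of f D z] by simp_all
qed

text \<open>Goursat's theorem on the complex line through \<open>p\<close> in the direction \<open>u\<close> makes the derivative
  continuous.\<close>

lemma complex_differentiable_line_C1:
  fixes \<phi> :: "complex ^ 'm::finite \<Rightarrow> complex ^ 'n::finite"
  assumes W: "open W" and \<phi>: "\<And>z. z \<in> W \<Longrightarrow> complex_differentiable_at (\<lambda>v. \<i> *s v) \<phi> z"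
  shows "(\<lambda>t. \<phi> (p + t *\<^sub>R u)) C1_differentiable_on {t. p + t *\<^sub>R u \<in> W}"
    and "p + t *\<^sub>R u \<in> W \<Longrightarrow>
      ((\<lambda>t. \<phi> (p + t *\<^sub>R u)) has_vector_derivative frechet_derivative \<phi> (at (p + t *\<^sub>R u)) u) (at t)"
proof -
  define D where "D z = frechet_derivative \<phi> (at z)" for z
  have D: "(\<phi> has_derivative D z) (at z)" "D z (\<i> *s v) = \<i> *s D z v" if "z \<in> W" for z v
    using complex_differentiable_at_frechet_derivative[OF \<phi>[OF that]] by (auto simp: D_def)
  have D_smult: "D z (a *s v) = a *s D z v" if "z \<in> W" for z a v
  proof -
    have lin: "linear (D z)"
      using D(1)[OF that] has_derivative_linear by blast
    show ?thesis
      unfolding complex_smult_split[of a]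
      by (simp add: linear_add[OF lin] linear_cmul[OF lin] D(2)[OF that])
  qed
  \<comment> \<open>The line is given a complex parameter so that one-variable theory applies; real
    parameters are restored through \<open>lt\<close> at the end.\<close>
  define l where "l \<zeta> = p + \<zeta> *s u" for \<zeta>
  define W' where "W' = {\<zeta>. l \<zeta> \<in> W}"
  have "linear (\<lambda>h :: complex. h *s u)"
    by (rule linearI) (simp_all add: vec_eq_iff algebra_simps)
  then have l: "(l has_derivative (\<lambda>h. h *s u)) (at \<zeta>)" for \<zeta>
    unfolding l_def
    by (auto intro!: derivative_eq_intros bounded_linear_imp_has_derivative
        simp: linear_conv_bounded_linear)
  have "open W'"
    unfolding W'_def using continuous_open_vimage[OF \<open>open W\<close>, of l] l
    by (auto simp: vimage_def dest: has_derivative_continuous)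
  \<comment> \<open>Complex linearity of \<open>D\<close> makes the derivative along the line
    multiplication by a complex number, so each coordinate is holomorphic in one variable.\<close>
  have h: "((\<lambda>\<zeta>. \<phi> (l \<zeta>) $ k) has_field_derivative D (l \<zeta>) u $ k) (at \<zeta>)" if "\<zeta> \<in> W'" for \<zeta> k
  proof -
    have "l \<zeta> \<in> W"
      using that by (simp add: W'_def)
    have "((\<lambda>\<zeta>. \<phi> (l \<zeta>)) has_derivative (\<lambda>h. D (l \<zeta>) (h *s u))) (at \<zeta>)"
      using has_derivative_compose[OF l D(1)[OF \<open>l \<zeta> \<in> W\<close>]] .
    then have "((\<lambda>\<zeta>. \<phi> (l \<zeta>) $ k) has_derivative (\<lambda>h. D (l \<zeta>) (h *s u) $ k)) (at \<zeta>)"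
      by (rule bounded_linear.has_derivative[OF bounded_linear_vec_nth])
    moreover have "(\<lambda>h. D (l \<zeta>) (h *s u) $ k) = (*) (D (l \<zeta>) u $ k)"
      by (simp add: fun_eq_iff D_smult[OF \<open>l \<zeta> \<in> W\<close>])
    ultimately show ?thesis
      by (simp add: has_field_derivative_def)
  qed
  have "continuous_on W' (\<lambda>\<zeta>. D (l \<zeta>) u $ k)" for k
  proof -
    have "(\<lambda>\<zeta>. \<phi> (l \<zeta>) $ k) holomorphic_on W'"
      using h holomorphic_on_open[OF \<open>open W'\<close>] by blast
    then have "continuous_on W' (deriv (\<lambda>\<zeta>. \<phi> (l \<zeta>) $ k))"
      using holomorphic_deriv[OF _ \<open>open W'\<close>] holomorphic_on_imp_continuous_on by blast
    then show ?thesis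
      by (rule continuous_on_eq) (simp add: DERIV_imp_deriv[OF h])
  qed
  then have "continuous_on W' (\<lambda>\<zeta>. \<chi> k. D (l \<zeta>) u $ k)"
    by (rule continuous_on_vec_lambda)
  then have cont: "continuous_on W' (\<lambda>\<zeta>. D (l \<zeta>) u)"
    by simp
  have lt: "l (of_real t) = p + t *\<^sub>R u" for t
    by (simp add: l_def scaleR_eq_complex_smult)
  have "continuous_on {t. p + t *\<^sub>R u \<in> W} (\<lambda>t. D (l (of_real t)) u)"
    by (rule continuous_on_compose2[OF cont])
      (auto intro!: continuous_intros simp: W'_def lt)
  then have cont': "continuous_on {t. p + t *\<^sub>R u \<in> W} (\<lambda>t. D (p + t *\<^sub>R u) u)"
    by (simp add: lt)
  have deriv: "((\<lambda>t. \<phi> (p + t *\<^sub>R u)) has_vector_derivative D (p + t *\<^sub>R u) u) (at t)"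
    if "p + t *\<^sub>R u \<in> W" for t
  proof -
    have "((\<lambda>t. p + t *\<^sub>R u) has_derivative (\<lambda>h. h *\<^sub>R u)) (at t)"
      by (auto intro!: derivative_eq_intros)
    from has_derivative_compose[OF this D(1)[OF that]] show ?thesis
      by (simp add: has_vector_derivative_def linear_cmul[OF has_derivative_linear[OF D(1)[OF that]]])
  qed
  show "(\<lambda>t. \<phi> (p + t *\<^sub>R u)) C1_differentiable_on {t. p + t *\<^sub>R u \<in> W}"
    unfolding C1_differentiable_on_def
    by (intro exI[of _ "\<lambda>t. D (p + t *\<^sub>R u) u"] conjI ballI cont') (simp add: deriv)
  show "p + t *\<^sub>R u \<in> W \<Longrightarrow>
      ((\<lambda>t. \<phi> (p + t *\<^sub>R u)) has_vector_derivative frechet_derivative \<phi> (at (p + t *\<^sub>R u)) u) (at t)"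
    using deriv[of t] unfolding D_def .
qed

section \<open>Transfer and gluing of regularity\<close>

lemma smooth_on_imp_continuous_on:
  assumes "smooth_on S f"
  shows "continuous_on S f"
  unfolding continuous_on_eq_continuous_within
proof
  fix x assume "x \<in> S"
  then have "\<exists>W h. open W \<and> x \<in> W \<and> (\<forall>k. Ck_on k W h) \<and> (\<forall>y\<in>S \<inter> W. h y = f y)"
    using assms unfolding smooth_on_def by (rule bspec[rotated])
  then obtain W h where W: "open W" "x \<in> W" and "\<forall>k. Ck_on k W h" and eq: "\<forall>y\<in>S \<inter> W. h y = f y"
    by (elim exE conjE)
  then have "Ck_on 0 W h"
    by (elim allE)
  then have "continuous (at x) h"
    using W by (simp add: continuous_on_eq_continuous_at)
  then have "(h \<longlongrightarrow> h x) (at x within S)"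
    using continuous_at_imp_continuous_within continuous_within by fast
  moreover have "\<forall>\<^sub>F y in at x within S. h y = f y"
    unfolding eventually_at_topological using W eq by fast
  ultimately have "(f \<longlongrightarrow> h x) (at x within S)"
    by (rule Lim_transform_eventually)
  then show "continuous (at x within S) f"
    using W eq \<open>x \<in> S\<close> by (simp add: continuous_within)
qed

lemma C1_differentiable_on_transform:
  assumes "f C1_differentiable_on S" "open W" "S \<subseteq> W" "\<And>t. t \<in> W \<Longrightarrow> f t = g t"
  shows "g C1_differentiable_on S"
proof -
  obtain D where D: "\<And>t. t \<in> S \<Longrightarrow> (f has_vector_derivative D t) (at t)" "continuous_on S D"
    using assms(1) unfolding C1_differentiable_on_def by auto
  have "(g has_vector_derivative D t) (at t)" if "t \<in> S" for t
    by (rule has_vector_derivative_transform_within_open[OF D(1)[OF that] assms(2)])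
      (use that assms(3,4) in auto)
  then show ?thesis
    unfolding C1_differentiable_on_def using D(2) by auto
qed

text \<open>Continuity of the derivative is local on a relatively open cover. This joins the two
  halves of a concatenated curve once the junction time has been removed.\<close>

lemma C1_differentiable_on_Un_open:
  assumes "f C1_differentiable_on (S \<inter> U)" "f C1_differentiable_on (S \<inter> V)"
    and "open U" "open V" "S \<subseteq> U \<union> V"
  shows "f C1_differentiable_on S"
proof -
  have "continuous_on (S \<inter> U \<union> S \<inter> V) (\<lambda>x. vector_derivative f (at x))"
    using assms by (intro continuous_on_Un_local_open) (auto simp: C1_differentiable_on_eq openin_open)
  moreover have "S \<inter> U \<union> S \<inter> V = S"
    using assms(5) by blast
  ultimately show ?thesis
    using assms by (auto simp: C1_differentiable_on_eq)
qed

section \<open>Charts and curves in Kaehler manifolds\<close>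

locale complex_manifold_space =
  fixes M :: "('a, 'n::finite) cmanifold"
  assumes manifold: "complex_manifold M"
begin

lemma chart_dom_openin: "c \<in> charts M \<Longrightarrow> openin (space_top M) (chart_dom c)"
  using manifold by (simp add: complex_manifold_def)

lemma open_chart_image: "c \<in> charts M \<Longrightarrow> open (chart_image c)"
  using manifold by (simp add: complex_manifold_def)

lemma chart_dom_subset: "c \<in> charts M \<Longrightarrow> chart_dom c \<subseteq> topspace (space_top M)"
  by (rule openin_subset[OF chart_dom_openin])

lemma homeomorphic_chart:
  "c \<in> charts M \<Longrightarrow>
    homeomorphic_map (subtopology (space_top M) (chart_dom c)) (top_of_set (chart_image c)) (chart_map c)"
  using manifold by (simp add: complex_manifold_def)

lemma topspace_chart_dom:
  "c \<in> charts M \<Longrightarrow> topspace (subtopology (space_top M) (chart_dom c)) = chart_dom c"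
  by (simp add: Int_absorb1 chart_dom_subset)

lemma inj_on_chart: "c \<in> charts M \<Longrightarrow> inj_on (chart_map c) (chart_dom c)"
  using homeomorphic_imp_injective_map[OF homeomorphic_chart] by (simp only: topspace_chart_dom)

lemma chart_inv_chart_map: "c \<in> charts M \<Longrightarrow> x \<in> chart_dom c \<Longrightarrow> chart_inv c (chart_map c x) = x"
  by (rule inv_into_f_f[OF inj_on_chart])

lemma chart_inv_in_dom: "z \<in> chart_image c \<Longrightarrow> chart_inv c z \<in> chart_dom c"
  by (rule inv_into_into)

lemma chart_map_chart_inv: "z \<in> chart_image c \<Longrightarrow> chart_map c (chart_inv c z) = z"
  by (rule f_inv_into_f)

lemma chart_exists:
  assumes "x \<in> topspace (space_top M)"
  obtains c where "c \<in> charts M" "x \<in> chart_dom c"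
proof -
  have "x \<in> (\<Union>c\<in>charts M. chart_dom c)"
    using assms manifold by (simp add: complex_manifold_def)
  then show ?thesis
    using that by blast
qed

lemma open_chart_map_image:
  assumes "c \<in> charts M" "openin (space_top M) U" "U \<subseteq> chart_dom c"
  shows "open (chart_map c ` U)"
proof -
  have "openin (subtopology (space_top M) (chart_dom c)) U"
    using assms by (simp add: openin_open_subtopology[OF chart_dom_openin])
  then have "openin (top_of_set (chart_image c)) (chart_map c ` U)"
    using homeomorphic_imp_open_map[OF homeomorphic_chart[OF assms(1)]] by (simp add: open_map_def)
  then show ?thesis
    using open_chart_image[OF assms(1)] by (simp add: openin_open_eq)
qed

lemma openin_chart_preimage:
  assumes "c \<in> charts M" "open W"
  shows "openin (space_top M) {x \<in> chart_dom c. chart_map c x \<in> W}"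
proof -
  have "continuous_map (subtopology (space_top M) (chart_dom c)) euclidean (chart_map c)"
    using homeomorphic_imp_continuous_map[OF homeomorphic_chart[OF assms(1)]]
    by (simp add: continuous_map_in_subtopology)
  from openin_continuous_map_preimage[OF this, of W]
  have "openin (subtopology (space_top M) (chart_dom c)) {x \<in> chart_dom c. chart_map c x \<in> W}"
    using assms(2) by (simp only: topspace_chart_dom[OF assms(1)] open_openin[symmetric])
  then show ?thesis
    using openin_trans_full chart_dom_openin[OF assms(1)] by blast
qed

lemma continuous_map_chart_inv:
  assumes "c \<in> charts M"
  shows "continuous_map (top_of_set (chart_image c)) (space_top M) (chart_inv c)"
proof -
  obtain g where g: "homeomorphic_maps (subtopology (space_top M) (chart_dom c))
      (top_of_set (chart_image c)) (chart_map c) g"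
    using homeomorphic_chart[OF assms] by (auto simp: homeomorphic_map_maps)
  have "continuous_map (top_of_set (chart_image c)) (space_top M) g"
    using g by (auto simp: homeomorphic_maps_def continuous_map_in_subtopology)
  moreover have "g z = chart_inv c z" if "z \<in> chart_image c" for z
    using g chart_inv_in_dom[OF that] chart_map_chart_inv[OF that]
    unfolding homeomorphic_maps_def topspace_chart_dom[OF assms] by metis
  ultimately show ?thesis
    by (rule continuous_map_eq) simp
qed

lemma transition_differentiable:
  assumes "c \<in> charts M" "d \<in> charts M" "x \<in> chart_dom c" "x \<in> chart_dom d"
  shows "complex_differentiable_at (\<lambda>v. \<i> *s v) (local_rep c d id) (chart_map c x)"
  using assms manifold by (simp add: complex_manifold_def)

end

locale kaehler_manifold = complex_manifold_space M for M :: "('a, 'n::finite) cmanifold" +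
  fixes \<omega> :: "('a, 'n) tensor2"
  assumes kaehler: "kaehler_form M \<omega>"
begin

lemma positive_form:
  assumes "c \<in> charts M" "z \<in> chart_image c"
  shows "positive_form (\<omega> c z)"
proof (rule positive_form.intro)
  note K = kaehler[unfolded kaehler_form_def, THEN conjunct2, THEN bspec[OF _ assms(1)],
      THEN conjunct2, THEN bspec[OF _ assms(2)]]
  show "bilinear (\<omega> c z)"
    by (rule K[THEN conjunct1])
  show "\<omega> c z w v = - \<omega> c z v w" for v w
    by (rule K[THEN conjunct2, THEN conjunct1, rule_format])
  show "\<omega> c z (\<i> *s v) (\<i> *s w) = \<omega> c z v w" for v w
    by (rule K[THEN conjunct2, THEN conjunct2, THEN conjunct1, rule_format])
  show "v \<noteq> 0 \<Longrightarrow> 0 < \<omega> c z v (\<i> *s v)" for v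
    by (rule K[THEN conjunct2, THEN conjunct2, THEN conjunct2, THEN conjunct1, rule_format])
qed

lemma change_of_charts:
  assumes "c \<in> charts M" "d \<in> charts M" "x \<in> chart_dom c" "x \<in> chart_dom d"
  defines "D \<equiv> frechet_derivative (local_rep c d id) (at (chart_map c x))"
  shows "\<omega> d (chart_map d x) (D v) (D w) = \<omega> c (chart_map c x) v w"
proof -
  have "preserved_by M id \<omega>"
    using kaehler unfolding kaehler_form_def by (rule conjunct1)
  then have "id x \<in> chart_dom d \<longrightarrow> (\<forall>v w. \<omega> c (chart_map c x) v w = \<omega> d (chart_map d (id x)) (D v) (D w))"
    unfolding preserved_by_def D_def using assms(1-3) by blast
  then show ?thesis
    using assms(4) by simp
qed

text \<open>Smoothness of the form is given only for fixed vectors. Expanding both arguments in the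
  finite real basis yields joint continuity in point and vector, which the compactness bound on a
  coordinate ball requires.\<close>

lemma continuous_on_form:
  assumes "c \<in> charts M"
  shows "continuous_on (chart_image c \<times> UNIV) (\<lambda>(z, v). \<omega> c z v (\<i> *s v))"
proof -
  have "continuous_on (chart_image c) (\<lambda>z. \<omega> c z v w)" for v w
    using kaehler assms unfolding kaehler_form_def by (blast intro: smooth_on_imp_continuous_on)
  then have cont: "continuous_on (chart_image c \<times> UNIV)
      (\<lambda>p. \<Sum>b\<in>Basis. \<Sum>b'\<in>Basis. (snd p \<bullet> b) * ((\<i> *s snd p) \<bullet> b') * \<omega> c (fst p) b b')"
    by (intro continuous_intros continuous_on_compose2[of _ "\<lambda>z. \<omega> c z _ _" _ fst]) auto
  have expand: "(\<Sum>b\<in>Basis. \<Sum>b'\<in>Basis. (v \<bullet> b) * (w \<bullet> b') * \<omega> c z b b') = \<omega> c z v w"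
    if "z \<in> chart_image c" for z v w
  proof -
    have bil: "bilinear (\<omega> c z)"
      using positive_form[OF assms that] by (rule positive_form.bilinear)
    have "\<omega> c z v w = \<omega> c z (\<Sum>b\<in>Basis. (v \<bullet> b) *\<^sub>R b) (\<Sum>b\<in>Basis. (w \<bullet> b) *\<^sub>R b)"
      by (simp add: euclidean_representation)
    then show ?thesis
      unfolding bilinear_sum[OF bil] sum.cartesian_product
      by (simp add: bilinear_lmul[OF bil] bilinear_rmul[OF bil] case_prod_unfold mult_ac)
  qed
  show ?thesis
  proof (rule continuous_on_eq[OF cont])
    fix p assume "p \<in> chart_image c \<times> (UNIV :: (complex ^ 'n) set)"
    then show "(\<Sum>b\<in>Basis. \<Sum>b'\<in>Basis. (snd p \<bullet> b) * ((\<i> *s snd p) \<bullet> b') * \<omega> c (fst p) b b')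
        = (case p of (z, v) \<Rightarrow> \<omega> c z v (\<i> *s v))"
      by (simp only: case_prod_unfold expand mem_Times_iff)
  qed
qed

text \<open>Curves of bounded speed, instead of the distance, can be concatenated without computing integrals.
  The endpoints are exceptional because the derivatives in \<^const>\<open>C1_differentiable_on\<close> are
  two-sided.\<close>

definition joining_curve :: "real \<Rightarrow> (real \<Rightarrow> 'a) \<Rightarrow> real set \<Rightarrow> bool" where
  "joining_curve B \<gamma> S \<longleftrightarrow> pathin (space_top M) \<gamma> \<and> finite S \<and> {0, 1} \<subseteq> S \<and>
     (\<forall>c\<in>charts M.
        (chart_map c \<circ> \<gamma>) C1_differentiable_on {t \<in> {0..1} - S. \<gamma> t \<in> chart_dom c} \<and>
        (\<forall>t\<in>{0..1} - S. \<gamma> t \<in> chart_dom c \<longrightarrow>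
           (let v = vector_derivative (chart_map c \<circ> \<gamma>) (at t)
            in \<omega> c (chart_map c (\<gamma> t)) v (\<i> *s v) \<le> B)))"

definition joinable :: "real \<Rightarrow> 'a \<Rightarrow> 'a \<Rightarrow> bool" where
  "joinable B x y \<longleftrightarrow> (\<exists>\<gamma> S. joining_curve B \<gamma> S \<and> \<gamma> 0 = x \<and> \<gamma> 1 = y)"

lemma joinable_mono: "joinable B x y \<Longrightarrow> B \<le> B' \<Longrightarrow> joinable B' x y"
proof -
  assume "joinable B x y" "B \<le> B'"
  then obtain \<gamma> S where j: "joining_curve B \<gamma> S" "\<gamma> 0 = x" "\<gamma> 1 = y"
    unfolding joinable_def by blast
  have "joining_curve B' \<gamma> S"
    using j(1) unfolding joining_curve_def Let_def by (auto intro!: order_trans[OF _ \<open>B \<le> B'\<close>])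
  then show "joinable B' x y"
    unfolding joinable_def using j(2,3) by blast
qed

text \<open>Each curve is run at double speed on half of the interval, and the bounded quantity is
  the squared speed, hence the factor 4.\<close>

lemma joinable_trans:
  assumes "joinable B x y" "joinable B y z"
  shows "joinable (4 * B) x z"
proof -
  obtain \<gamma>1 S1 \<gamma>2 S2 where j1: "joining_curve B \<gamma>1 S1" "\<gamma>1 0 = x" "\<gamma>1 1 = y"
    and j2: "joining_curve B \<gamma>2 S2" "\<gamma>2 0 = y" "\<gamma>2 1 = z"
    using assms unfolding joinable_def by blast
  define \<gamma> where "\<gamma> t = (if t \<le> 1 / 2 then \<gamma>1 (2 * t) else \<gamma>2 (2 * t - 1))" for t
  \<comment> \<open>The rescaled exceptional times of both curves, together with the endpoints and
    the junction 1/2, where the one-sided derivatives may differ.\<close>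
  define S where "S = {0, 1 / 2, 1} \<union> (\<lambda>t. t / 2) ` S1 \<union> (\<lambda>t. (t + 1) / 2) ` S2"
  have S1: "2 * t \<in> {0..1} - S1" if "t \<in> {0..1} - S" "t < 1 / 2" for t
    using that rev_image_eqI[of "2 * t" S1 t "\<lambda>t. t / 2"] by (auto simp: S_def)
  have S2: "2 * t - 1 \<in> {0..1} - S2" if "t \<in> {0..1} - S" "1 / 2 < t" for t
    using that rev_image_eqI[of "2 * t - 1" S2 t "\<lambda>t. (t + 1) / 2"] by (auto simp: S_def)
  have "pathin (space_top M) \<gamma>"
    unfolding pathin_def \<gamma>_def
  proof (rule continuous_map_cases_le)
    show "continuous_map (subtopology (top_of_set {0..1}) {t \<in> topspace (top_of_set {0..1}). t \<le> 1 / 2})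
        (space_top M) (\<lambda>t. \<gamma>1 (2 * t))"
      by (rule continuous_map_compose[of _ "top_of_set {0..1}" "\<lambda>t. 2 * t" _ \<gamma>1, unfolded o_def])
        (use j1(1) in \<open>auto simp: joining_curve_def pathin_def subtopology_subtopology intro!: continuous_intros\<close>)
    show "continuous_map (subtopology (top_of_set {0..1}) {t \<in> topspace (top_of_set {0..1}). 1 / 2 \<le> t})
        (space_top M) (\<lambda>t. \<gamma>2 (2 * t - 1))"
      by (rule continuous_map_compose[of _ "top_of_set {0..1}" "\<lambda>t. 2 * t - 1" _ \<gamma>2, unfolded o_def])
        (use j2(1) in \<open>auto simp: joining_curve_def pathin_def subtopology_subtopology intro!: continuous_intros\<close>)
    show "\<gamma>1 (2 * t) = \<gamma>2 (2 * t - 1)" if "t = 1 / 2" for t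
      unfolding that using j1 j2 by simp
  qed auto
  have C1: "(chart_map c \<circ> \<gamma>) C1_differentiable_on {t \<in> {0..1} - S. \<gamma> t \<in> chart_dom c}" (is "_ C1_differentiable_on ?A")
    if c: "c \<in> charts M" for c
  proof (rule C1_differentiable_on_Un_open[of _ _ "{..<1/2}" "{1/2<..}"])
    have sub: "(\<lambda>t. 2 * t) ` (?A \<inter> {..<1/2}) \<subseteq> {t \<in> {0..1} - S1. \<gamma>1 t \<in> chart_dom c}"
      using S1 by (auto simp: \<gamma>_def)
    have "((chart_map c \<circ> \<gamma>1) \<circ> (\<lambda>t. 2 * t)) C1_differentiable_on (?A \<inter> {..<1/2})"
    proof (rule C1_differentiable_compose)
      show "(chart_map c \<circ> \<gamma>1) C1_differentiable_on (\<lambda>t. 2 * t) ` (?A \<inter> {..<1/2})"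
        by (rule C1_differentiable_on_subset[OF _ sub]) (use j1(1) c in \<open>simp add: joining_curve_def\<close>)
      show "finite (?A \<inter> {..<1/2} \<inter> (\<lambda>t. 2 * t) -` {r})" for r
        by (rule finite_subset[of _ "{r / 2}"]) auto
    qed simp
    then show "(chart_map c \<circ> \<gamma>) C1_differentiable_on (?A \<inter> {..<1/2})"
      by (rule C1_differentiable_on_transform[of _ _ "{..<1/2}"]) (auto simp: \<gamma>_def)
    have sub: "(\<lambda>t. 2 * t - 1) ` (?A \<inter> {1/2<..}) \<subseteq> {t \<in> {0..1} - S2. \<gamma>2 t \<in> chart_dom c}"
      using S2 by (auto simp: \<gamma>_def)
    have "((chart_map c \<circ> \<gamma>2) \<circ> (\<lambda>t. 2 * t - 1)) C1_differentiable_on (?A \<inter> {1/2<..})"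
    proof (rule C1_differentiable_compose)
      show "(chart_map c \<circ> \<gamma>2) C1_differentiable_on (\<lambda>t. 2 * t - 1) ` (?A \<inter> {1/2<..})"
        by (rule C1_differentiable_on_subset[OF _ sub]) (use j2(1) c in \<open>simp add: joining_curve_def\<close>)
      show "finite (?A \<inter> {1/2<..} \<inter> (\<lambda>t. 2 * t - 1) -` {r})" for r
        by (rule finite_subset[of _ "{(r + 1) / 2}"]) auto
    qed simp
    then show "(chart_map c \<circ> \<gamma>) C1_differentiable_on (?A \<inter> {1/2<..})"
      by (rule C1_differentiable_on_transform[of _ _ "{1/2<..}"]) (auto simp: \<gamma>_def)
    show "?A \<subseteq> {..<1/2} \<union> {1/2<..}"
      by (auto simp: S_def)
  qed auto
  have speed: "\<omega> c (chart_map c (\<gamma> t)) v (\<i> *s v) \<le> 4 * B"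
    if c: "c \<in> charts M" and t: "t \<in> {0..1} - S" "\<gamma> t \<in> chart_dom c"
      and v: "v = vector_derivative (chart_map c \<circ> \<gamma>) (at t)" for c t v
  proof -
    \<comment> \<open>Both halves are treated at once: near \<open>t\<close> the curve is
      \<open>\<delta> (2 * s - a)\<close>, with \<open>a\<close> equal to 0 on the first half and 1
      on the second.\<close>
    obtain W \<delta> a where W: "open W" "t \<in> W" "\<And>s. s \<in> W \<Longrightarrow> \<gamma> s = \<delta> (2 * s - a)"
      and j: "\<exists>R. joining_curve B \<delta> R \<and> 2 * t - a \<in> {0..1} - R"
    proof (cases "t < 1 / 2")
      case True
      then have "\<exists>R. joining_curve B \<gamma>1 R \<and> 2 * t - 0 \<in> {0..1} - R"
        using S1[OF t(1)] j1(1) by (intro exI[of _ S1]) simp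
      then show ?thesis
        using that[of "{..<1/2}" \<gamma>1 0] True by (simp add: \<gamma>_def)
    next
      case False
      then have "t > 1 / 2"
        using t by (auto simp: S_def)
      moreover from this have "\<exists>R. joining_curve B \<gamma>2 R \<and> 2 * t - 1 \<in> {0..1} - R"
        using S2[OF t(1)] j2(1) by (intro exI[of _ S2]) simp
      ultimately show ?thesis
        using that[of "{1/2<..}" \<gamma>2 1] by (simp add: \<gamma>_def)
    qed
    define \<tau> where "\<tau> = 2 * t - a"
    have \<gamma>t: "\<gamma> t = \<delta> \<tau>"
      using W(2,3) by (simp add: \<tau>_def)
    define u where "u = vector_derivative (chart_map c \<circ> \<delta>) (at \<tau>)"
    have "(chart_map c \<circ> \<delta>) differentiable (at \<tau>)" and le: "\<omega> c (chart_map c (\<gamma> t)) u (\<i> *s u) \<le> B"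
      using j c t(2) unfolding \<gamma>t u_def \<tau>_def[symmetric] joining_curve_def C1_differentiable_on_eq Let_def by auto
    then have "((chart_map c \<circ> \<delta>) has_vector_derivative u) (at (2 * t - a))"
      by (simp add: u_def \<tau>_def vector_derivative_works)
    moreover have "((\<lambda>s. 2 * s - a) has_vector_derivative 2) (at t)"
      by (auto intro!: derivative_eq_intros)
    ultimately have "((\<lambda>s. chart_map c (\<delta> (2 * s - a))) has_vector_derivative 2 *\<^sub>R u) (at t)"
      using vector_diff_chain_at[of "\<lambda>s. 2 * s - a" 2 t "chart_map c \<circ> \<delta>" u] by (simp add: o_def)
    then have "((chart_map c \<circ> \<gamma>) has_vector_derivative 2 *\<^sub>R u) (at t)"
      by (rule has_vector_derivative_transform_within_open[OF _ W(1,2)]) (simp add: W(3))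
    then have "v = 2 *\<^sub>R u"
      unfolding v by (rule vector_derivative_at)
    moreover have "\<i> *s (2 *\<^sub>R u) = 2 *\<^sub>R (\<i> *s u)"
      by (simp add: vec_eq_iff)
    ultimately have "\<omega> c (chart_map c (\<gamma> t)) v (\<i> *s v) = 4 * \<omega> c (chart_map c (\<gamma> t)) u (\<i> *s u)"
      using positive_form.bilinear[OF positive_form[OF c, of "chart_map c (\<gamma> t)"]] t(2)
      by (simp add: bilinear_lmul bilinear_rmul)
    then show ?thesis
      using le by simp
  qed
  have "finite S"
    using j1(1) j2(1) by (simp add: S_def joining_curve_def)
  then have "joining_curve (4 * B) \<gamma> S"
    unfolding joining_curve_def Let_def
    using \<open>pathin (space_top M) \<gamma>\<close> C1 speed by (auto simp: S_def)
  moreover have "\<gamma> 0 = x" "\<gamma> 1 = z"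
    using j1 j2 by (simp_all add: \<gamma>_def)
  ultimately show ?thesis
    unfolding joinable_def by blast
qed

text \<open>Points of a coordinate ball are joined by the straight segment in the chart; its squared
  speed is bounded by compactness of a set of pairs of a point and a vector. Both orders of
  \<open>y\<close> and \<open>z\<close> are covered, so curves never have to be reversed.\<close>

lemma locally_joinable:
  assumes "x \<in> topspace (space_top M)"
  shows "\<exists>U B. openin (space_top M) U \<and> x \<in> U \<and> (\<forall>y\<in>U. \<forall>z\<in>U. joinable B y z)"
proof -
  obtain c where c: "c \<in> charts M" "x \<in> chart_dom c"
    using chart_exists[OF assms] .
  obtain e where e: "e > 0" "cball (chart_map c x) e \<subseteq> chart_image c"
    using open_contains_cball open_chart_image[OF c(1)] c(2) by blast
  define U where "U = {y \<in> chart_dom c. chart_map c y \<in> ball (chart_map c x) e}"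
  \<comment> \<open>The radius \<open>2 * e\<close> bounds the constant velocity of a segment, a
    difference of two points of a ball of radius \<open>e\<close>.\<close>
  let ?K = "cball (chart_map c x) e \<times> cball 0 (2 * e)"
  have "compact ((\<lambda>(z, v). \<omega> c z v (\<i> *s v)) ` ?K)"
    by (rule compact_continuous_image[OF continuous_on_subset[OF continuous_on_form[OF c(1)]]])
      (use e in \<open>auto intro: compact_Times\<close>)
  then obtain B where bound: "\<forall>r\<in>(\<lambda>(z, v). \<omega> c z v (\<i> *s v)) ` ?K. norm r \<le> B"
    using compact_imp_bounded bounded_iff by blast
  then have B: "\<omega> c z v (\<i> *s v) \<le> B" if "z \<in> cball (chart_map c x) e" "norm v \<le> 2 * e" for z v
  proof -
    have "\<omega> c z v (\<i> *s v) \<in> (\<lambda>(z, v). \<omega> c z v (\<i> *s v)) ` ?K"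
      by (rule image_eqI[of _ _ "(z, v)"]) (use that in auto)
    then have "norm (\<omega> c z v (\<i> *s v)) \<le> B"
      using bound by blast
    then show ?thesis
      by simp
  qed
  have "joinable B y z" if "y \<in> U" "z \<in> U" for y z
  proof -
    define p where "p = chart_map c y"
    define u where "u = chart_map c z - chart_map c y"
    define \<gamma> where "\<gamma> t = chart_inv c (p + t *\<^sub>R u)" for t
    have ends: "\<gamma> 0 = y" "\<gamma> 1 = z"
      using that c(1) by (simp_all add: \<gamma>_def p_def u_def U_def chart_inv_chart_map)
    have ball: "p + t *\<^sub>R u \<in> ball (chart_map c x) e" if "t \<in> {0..1}" for t
    proof -
      have "p + t *\<^sub>R u = (1 - t) *\<^sub>R chart_map c y + t *\<^sub>R chart_map c z"
        by (simp add: p_def u_def algebra_simps)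
      then show ?thesis
        using convexD[OF convex_ball, of "chart_map c y" "chart_map c x" e "chart_map c z" "1 - t" t]
          \<open>y \<in> U\<close> \<open>z \<in> U\<close> that by (simp add: U_def)
    qed
    have "norm u \<le> 2 * e"
      using that norm_triangle_ineq4[of "chart_map c z - chart_map c x" "chart_map c y - chart_map c x"]
      by (auto simp: U_def u_def dist_norm norm_minus_commute)
    have image: "p + t *\<^sub>R u \<in> chart_image c" if "t \<in> {0..1}" for t
      using ball[OF that] e(2) by auto
    have "pathin (space_top M) \<gamma>"
      unfolding pathin_def \<gamma>_def
      by (rule continuous_map_compose[of _ _ "\<lambda>t. p + t *\<^sub>R u", OF _ continuous_map_chart_inv[OF c(1)], unfolded o_def])
        (use image in \<open>auto intro!: continuous_intros\<close>)
    have C1: "(chart_map d \<circ> \<gamma>) C1_differentiable_on {t \<in> {0..1} - {0, 1}. \<gamma> t \<in> chart_dom d}"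
      and speed: "t \<in> {0..1} \<Longrightarrow> \<gamma> t \<in> chart_dom d \<Longrightarrow> v = vector_derivative (chart_map d \<circ> \<gamma>) (at t) \<Longrightarrow>
        \<omega> d (chart_map d (\<gamma> t)) v (\<i> *s v) \<le> B"
      if d: "d \<in> charts M" for d t v
    proof -
      \<comment> \<open>Regularity and speed are demanded in every chart \<open>d\<close> the
        segment meets, so on this overlap the segment is composed with the transition map, whose
        derivative is continuous along lines.\<close>
      define W where "W = chart_map c ` (chart_dom c \<inter> chart_dom d)"
      have "open W"
        unfolding W_def
        by (rule open_chart_map_image[OF c(1)]) (use c(1) d chart_dom_openin in blast)+
      have W: "complex_differentiable_at (\<lambda>v. \<i> *s v) (local_rep c d id) z" if "z \<in> W" for z
        using that transition_differentiable[OF c(1) d] by (auto simp: W_def)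
      have \<gamma>_rep: "chart_map d \<circ> \<gamma> = (\<lambda>t. local_rep c d id (p + t *\<^sub>R u))"
        by (simp add: fun_eq_iff local_rep_def \<gamma>_def)
      have in_dom: "\<gamma> t \<in> chart_dom c" "chart_map c (\<gamma> t) = p + t *\<^sub>R u" if "t \<in> {0..1}" for t
        using chart_inv_in_dom[OF image[OF that]] chart_map_chart_inv[OF image[OF that]]
        by (simp_all add: \<gamma>_def)
      have in_W: "p + t *\<^sub>R u \<in> W" if "t \<in> {0..1}" "\<gamma> t \<in> chart_dom d" for t
        unfolding W_def using in_dom[OF that(1)] that(2) by (metis IntI imageI)
      show "(chart_map d \<circ> \<gamma>) C1_differentiable_on {t \<in> {0..1} - {0, 1}. \<gamma> t \<in> chart_dom d}"
        unfolding \<gamma>_rep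
        by (rule C1_differentiable_on_subset[OF complex_differentiable_line_C1(1)[OF \<open>open W\<close> W]])
          (use in_W in auto)
      assume t: "t \<in> {0..1}" "\<gamma> t \<in> chart_dom d" "v = vector_derivative (chart_map d \<circ> \<gamma>) (at t)"
      let ?D = "frechet_derivative (local_rep c d id) (at (chart_map c (\<gamma> t)))"
      \<comment> \<open>The velocity in \<open>d\<close> is the transition derivative of
        \<open>u\<close>. As that derivative commutes with \<i>, the squared speed is the one
        already bounded in \<open>c\<close>.\<close>
      have "v = ?D u"
        unfolding t(3) \<gamma>_rep in_dom(2)[OF t(1)]
        by (rule vector_derivative_at[OF complex_differentiable_line_C1(2)[OF \<open>open W\<close> W in_W[OF t(1,2)]]])
      moreover have "?D (\<i> *s u) = \<i> *s ?D u"
        by (rule complex_differentiable_at_frechet_derivative(2)[OF W])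
          (use in_W[OF t(1,2)] in_dom(2)[OF t(1)] in simp)
      ultimately have "\<omega> d (chart_map d (\<gamma> t)) v (\<i> *s v) = \<omega> c (p + t *\<^sub>R u) u (\<i> *s u)"
        using change_of_charts[OF c(1) d in_dom(1)[OF t(1)] t(2), of u "\<i> *s u"]
        by (simp add: in_dom(2)[OF t(1)])
      then show "\<omega> d (chart_map d (\<gamma> t)) v (\<i> *s v) \<le> B"
        using B[of "p + t *\<^sub>R u" u] ball[OF t(1)] \<open>norm u \<le> 2 * e\<close> by simp
    qed
    have "joining_curve B \<gamma> {0, 1}"
      unfolding joining_curve_def Let_def
      using \<open>pathin (space_top M) \<gamma>\<close> C1 speed by auto
    then show ?thesis
      unfolding joinable_def using ends by blast
  qed
  moreover have "openin (space_top M) U" "x \<in> U"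
    using openin_chart_preimage[OF c(1), of "ball (chart_map c x) e"] c e(1) by (simp_all add: U_def)
  ultimately show ?thesis
    by blast
qed

text \<open>The points reachable from \<open>x\<close> with some bound form a nonempty clopen set.
  The bound stays existential because every concatenation multiplies it by 4.\<close>

lemma connected_imp_joinable:
  assumes "connected_space (space_top M)" "x \<in> topspace (space_top M)" "y \<in> topspace (space_top M)"
  shows "\<exists>B. joinable B x y"
proof -
  define R where "R y z \<longleftrightarrow> (\<exists>B. joinable B y z)" for y z
  have R_trans: "R y w" if R: "R y z" "R z w" for y z w
  proof -
    obtain B1 B2 where "joinable B1 y z" "joinable B2 z w"
      using R unfolding R_def by blast
    then have "joinable (max B1 B2) y z" "joinable (max B1 B2) z w"
      using joinable_mono by auto
    then show ?thesis
      unfolding R_def using joinable_trans by blast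
  qed
  have R_local: "\<exists>U. openin (space_top M) U \<and> y \<in> U \<and> (\<forall>z\<in>U. \<forall>w\<in>U. R z w)"
    if "y \<in> topspace (space_top M)" for y
  proof -
    from locally_joinable[OF that]
    obtain U B where "openin (space_top M) U" "y \<in> U" "\<forall>z\<in>U. \<forall>w\<in>U. joinable B z w"
      by (elim exE conjE)
    then show ?thesis
      by (intro exI[of _ U]) (auto simp: R_def)
  qed
  let ?T = "{y \<in> topspace (space_top M). R x y}"
  have "openin (space_top M) ?T"
    unfolding openin_subopen[of _ ?T]
  proof
    fix y assume y: "y \<in> ?T"
    then obtain U where U: "openin (space_top M) U" "y \<in> U" "\<forall>z\<in>U. \<forall>w\<in>U. R z w"
      using R_local[of y] by auto
    have "U \<subseteq> ?T"
    proof
      fix z assume "z \<in> U"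
      then show "z \<in> ?T"
        using y U R_trans[of x y z] openin_subset[OF U(1)] by auto
    qed
    then show "\<exists>U. openin (space_top M) U \<and> y \<in> U \<and> U \<subseteq> ?T"
      using U by blast
  qed
  moreover have "openin (space_top M) (topspace (space_top M) - ?T)"
    unfolding openin_subopen[of _ "topspace (space_top M) - ?T"]
  proof
    fix y assume y: "y \<in> topspace (space_top M) - ?T"
    then obtain U where U: "openin (space_top M) U" "y \<in> U" "\<forall>z\<in>U. \<forall>w\<in>U. R z w"
      using R_local[of y] by auto
    \<comment> \<open>If \<open>z\<close> in \<open>U\<close> were reachable from \<open>x\<close>,
      then so would be \<open>y\<close>, because \<open>U\<close> also joins \<open>z\<close> to
      \<open>y\<close>.\<close>
    have "U \<subseteq> topspace (space_top M) - ?T"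
    proof
      fix z assume "z \<in> U"
      then show "z \<in> topspace (space_top M) - ?T"
        using y U R_trans[of x z y] openin_subset[OF U(1)] by auto
    qed
    then show "\<exists>U. openin (space_top M) U \<and> y \<in> U \<and> U \<subseteq> topspace (space_top M) - ?T"
      using U by blast
  qed
  moreover have "x \<in> ?T"
    using R_local[OF assms(2)] assms(2) by auto
  ultimately have "?T = topspace (space_top M)"
    using assms(1) unfolding connected_space_clopen_in closedin_def by blast
  then show ?thesis
    using assms(3) R_def by blast
qed

text \<open>A finite cover by sets with a bound of their own leaves finitely many constants: one for
  each set, and one for each pair of chosen base points. Any two points are joined through the base
  points of their sets.\<close>

lemma compact_imp_uniformly_joinable:
  assumes "connected_space (space_top M)" "compact_space (space_top M)"
  obtains B where
    "\<And>x y. x \<in> topspace (space_top M) \<Longrightarrow> y \<in> topspace (space_top M) \<Longrightarrow> joinable B x y"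
proof -
  define small where "small U B \<longleftrightarrow> (\<forall>y\<in>U. \<forall>z\<in>U. joinable B y z)" for U B
  have "\<exists>\<F>. finite \<F> \<and> \<F> \<subseteq> {U. openin (space_top M) U \<and> (\<exists>B. small U B)} \<and> topspace (space_top M) \<subseteq> \<Union>\<F>"
  proof -
    have "topspace (space_top M) \<subseteq> \<Union>{U. openin (space_top M) U \<and> (\<exists>B. small U B)}"
    proof
      fix x assume "x \<in> topspace (space_top M)"
      then have "\<exists>U B. openin (space_top M) U \<and> x \<in> U \<and> small U B"
        unfolding small_def by (rule locally_joinable)
      then show "x \<in> \<Union>{U. openin (space_top M) U \<and> (\<exists>B. small U B)}"
        by blast
    qed
    then show ?thesis
      using assms(2) unfolding compact_space_alt by auto
  qed
  then obtain \<F> where \<F>0: "finite \<F>" "\<F> \<subseteq> {U. openin (space_top M) U \<and> (\<exists>B. small U B)}"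
      "topspace (space_top M) \<subseteq> \<Union>\<F>"
    by (elim exE conjE)
  have \<F>: "U \<subseteq> topspace (space_top M)" "\<exists>B. small U B" if "U \<in> \<F>" for U
    using \<F>0(2) that openin_subset[of "space_top M" U] by auto
  \<comment> \<open>Empty members are dropped so that every set has a base point.\<close>
  define \<F>' where "\<F>' = \<F> - {{}}"
  define pt where "pt U = (SOME x. x \<in> U)" for U :: "'a set"
  have pt: "pt U \<in> U" if "U \<in> \<F>'" for U
    unfolding pt_def by (rule someI_ex) (use that in \<open>auto simp: \<F>'_def\<close>)
  define b where "b U = (SOME B. small U B)" for U
  have b: "small U (b U)" if "U \<in> \<F>'" for U
    unfolding b_def by (rule someI_ex) (use that \<F>(2)[of U] in \<open>simp add: \<F>'_def\<close>)
  define b' where "b' U V = (SOME B. joinable B (pt U) (pt V))" for U V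
  have b': "joinable (b' U V) (pt U) (pt V)" if "U \<in> \<F>'" "V \<in> \<F>'" for U V
  proof -
    have "pt U \<in> topspace (space_top M)" "pt V \<in> topspace (space_top M)"
      using pt[OF that(1)] pt[OF that(2)] \<F>(1)[of U] \<F>(1)[of V] that unfolding \<F>'_def by blast+
    from connected_imp_joinable[OF assms(1) this] show ?thesis
      unfolding b'_def by (rule someI_ex)
  qed
  have fin: "finite (b ` \<F>' \<union> (\<lambda>(U, V). b' U V) ` (\<F>' \<times> \<F>'))"
    using \<F>0(1) by (simp add: \<F>'_def)
  \<comment> \<open>Inserting 0 keeps the maximum defined for an empty cover and gives
    \<open>B \<ge> 0\<close>, so that bounds may be weakened from \<open>B\<close> to
    \<open>4 * B\<close>.\<close>
  define B where "B = Max (insert 0 (b ` \<F>' \<union> (\<lambda>(U, V). b' U V) ` (\<F>' \<times> \<F>')))"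
  have B: "B \<ge> 0" "\<And>U. U \<in> \<F>' \<Longrightarrow> b U \<le> B" "\<And>U V. U \<in> \<F>' \<Longrightarrow> V \<in> \<F>' \<Longrightarrow> b' U V \<le> B"
    unfolding B_def using fin by (auto intro!: Max_ge)
  \<comment> \<open>Three curves are needed. Both legs joined last carry the bound
    \<open>4 * B\<close>: the first is a concatenation, the second is weakened to match.\<close>
  have "joinable (4 * (4 * B)) x y"
    if xy: "x \<in> topspace (space_top M)" "y \<in> topspace (space_top M)" for x y
  proof -
    obtain U V where UV: "U \<in> \<F>'" "x \<in> U" "V \<in> \<F>'" "y \<in> V"
      using \<F>0(3) xy unfolding \<F>'_def by blast
    have "joinable (b U) x (pt U)" "joinable (b V) (pt V) y"
      using b[OF UV(1)] b[OF UV(3)] pt[OF UV(1)] pt[OF UV(3)] UV by (auto simp: small_def)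
    then have "joinable B x (pt U)" "joinable B (pt U) (pt V)" "joinable B (pt V) y"
      using b'[OF UV(1,3)] B(2)[OF UV(1)] B(2)[OF UV(3)] B(3)[OF UV(1,3)] by (auto intro: joinable_mono)
    then have "joinable (4 * B) x (pt V)" "joinable (4 * B) (pt V) y"
      using joinable_trans joinable_mono[of B _ _ "4 * B"] B(1) by auto
    then show ?thesis
      by (rule joinable_trans)
  qed
  then show ?thesis
    using that by blast
qed

end

section \<open>Homogeneous Kaehler manifolds\<close>

text \<open>\<open>A\<close> is any transitive set of maps that are holomorphic in charts; it will
  be the set of left translations by elements of the compact real form.\<close>

locale homogeneous_manifold = complex_manifold_space M for M :: "('a, 'n::finite) cmanifold" +
  fixes A :: "('a \<Rightarrow> 'a) set"
  assumes holomorphic: "f \<in> A \<Longrightarrow> c \<in> charts M \<Longrightarrow> d \<in> charts M \<Longrightarrow> x \<in> chart_dom c \<Longrightarrow>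
      f x \<in> chart_dom d \<Longrightarrow>
      complex_differentiable_at (\<lambda>v. \<i> *s v) (local_rep c d f) (chart_map c x)"
    and transitive: "x \<in> topspace (space_top M) \<Longrightarrow> y \<in> topspace (space_top M) \<Longrightarrow> \<exists>f\<in>A. f x = y"
begin

definition invariant_kaehler :: "('a, 'n) tensor2 \<Rightarrow> bool" where
  "invariant_kaehler \<omega> \<longleftrightarrow> kaehler_form M \<omega> \<and> (\<forall>f\<in>A. preserved_by M f \<omega>)"

lemma invariant_positive_form:
  assumes "invariant_kaehler \<omega>" "c \<in> charts M" "x \<in> chart_dom c"
  shows "positive_form (\<omega> c (chart_map c x))"
proof -
  interpret kaehler_manifold M \<omega>
    by unfold_locales (use assms(1) in \<open>simp add: invariant_kaehler_def\<close>)
  show ?thesis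
    using positive_form assms(2,3) by simp
qed

text \<open>One linear map \<open>D\<close> serves all invariant forms.\<close>

lemma invariant_pullback:
  assumes "c \<in> charts M" "d \<in> charts M" "x \<in> chart_dom c" "y \<in> chart_dom d"
  obtains D where "\<And>v. D (\<i> *s v) = \<i> *s D v"
    and "\<And>\<omega> v w. invariant_kaehler \<omega> \<Longrightarrow> \<omega> c (chart_map c x) v w = \<omega> d (chart_map d y) (D v) (D w)"
proof -
  have "x \<in> topspace (space_top M)" "y \<in> topspace (space_top M)"
    using assms chart_dom_subset by blast+
  from transitive[OF this] obtain f where f: "f \<in> A" "f x = y"
    by blast
  define D where "D = frechet_derivative (local_rep c d f) (at (chart_map c x))"
  have "complex_differentiable_at (\<lambda>v. \<i> *s v) (local_rep c d f) (chart_map c x)"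
    using f assms by (intro holomorphic) simp_all
  then have "D (\<i> *s v) = \<i> *s D v" for v
    unfolding D_def by (rule complex_differentiable_at_frechet_derivative(2))
  moreover have "\<omega> c (chart_map c x) v w = \<omega> d (chart_map d y) (D v) (D w)"
    if "invariant_kaehler \<omega>" for \<omega> v w
  proof -
    have "preserved_by M f \<omega>"
      using that f(1) by (simp add: invariant_kaehler_def)
    then have "f x \<in> chart_dom d \<longrightarrow>
        (\<forall>v w. \<omega> c (chart_map c x) v w = \<omega> d (chart_map d (f x)) (D v) (D w))"
      unfolding preserved_by_def D_def using assms(1-3) by blast
    then show ?thesis
      using assms(4) f(2) by blast
  qed
  ultimately show ?thesis
    by (rule that)
qed

text \<open>The volume densities of two invariant forms have constant quotient \<open>k\<close>. The sign of \<open>k\<close> does not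
  matter, since \<open>ln\<close> is the logarithm of the absolute value.\<close>

lemma ricci_form_unique:
  assumes inv: "invariant_kaehler \<omega>" "invariant_kaehler \<omega>'"
    and c: "c \<in> charts M" and z: "z \<in> chart_image c"
  shows "ricci_form \<omega> c z = ricci_form \<omega>' c z"
proof -
  obtain x where x: "x \<in> chart_dom c" "z = chart_map c x"
    using z by blast
  define g where "g y = det (metric_matrix \<omega> c y)" for y
  define g' where "g' y = det (metric_matrix \<omega>' c y)" for y
  have real_nonzero: "g y \<in> \<real>" "g' y \<in> \<real>" "Re (g y) \<noteq> 0" "Re (g' y) \<noteq> 0"
    if y: "y \<in> chart_image c" for y
  proof -
    obtain p where "p \<in> chart_dom c" "y = chart_map c p"
      using y by blast
    then have "positive_form (\<omega> c y)" "positive_form (\<omega>' c y)"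
      using invariant_positive_form[OF _ c] inv by blast+
    then show "g y \<in> \<real>" "g' y \<in> \<real>" "Re (g y) \<noteq> 0" "Re (g' y) \<noteq> 0"
      unfolding g_def g'_def metric_matrix_eq_gram
      by (simp_all add: positive_form.det_gram_matrix_real positive_form.Re_det_gram_matrix_nonzero)
  qed
  \<comment> \<open>Both determinants at \<open>y\<close> are those at \<open>z\<close> times the
    same |det D|^2, so cross-multiplication removes the factor without a division.\<close>
  have ratio: "g y * g' z = g' y * g z" if y: "y \<in> chart_image c" for y
  proof -
    obtain p where p: "p \<in> chart_dom c" "y = chart_map c p"
      using y by blast
    obtain D where D: "\<And>v. D (\<i> *s v) = \<i> *s D v"
        "\<And>\<omega> v w. invariant_kaehler \<omega> \<Longrightarrow> \<omega> c y v w = \<omega> c z (D v) (D w)"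
      using invariant_pullback[OF c c p(1) x(1)] unfolding p(2) x(2) by metis
    have "det (gram_matrix (\<alpha> c y)) = det (matrix D) * cnj (det (matrix D)) * det (gram_matrix (\<alpha> c z))"
      if "invariant_kaehler \<alpha>" for \<alpha>
      using positive_form.det_gram_matrix_pullback[of "\<alpha> c z" "\<alpha> c y" D]
        invariant_positive_form[OF that c x(1)] D(1) D(2)[OF that] x(2) by blast
    from this[OF inv(1)] this[OF inv(2)] show ?thesis
      by (simp add: g_def g'_def metric_matrix_eq_gram)
  qed
  define k where "k = Re (g z) / Re (g' z)"
  have "Re (g y) = k * Re (g' y)" if "y \<in> chart_image c" for y
    using arg_cong[OF ratio[OF that], of Re] real_nonzero[OF that] real_nonzero[OF z]
    by (simp add: k_def field_simps complex_is_Real_iff)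
  moreover have "k \<noteq> 0"
    using real_nonzero[OF z] by (simp add: k_def)
  ultimately have "ln (Re (g y)) = ln k + ln (Re (g' y))" if "y \<in> chart_image c" for y
    using real_nonzero[OF that] that by (simp add: ln_mult)
  then have "i_ddbar (\<lambda>y. ln (Re (g y))) z = i_ddbar (\<lambda>y. ln (Re (g' y))) z"
    by (rule i_ddbar_cong_const[OF open_chart_image[OF c] z])
  then show ?thesis
    by (simp add: ricci_form_def g_def g'_def)
qed

text \<open>\<open>dominates\<close> supplies \<open>K\<close> at one point. Both forms elsewhere
  are pullbacks from there by one map \<open>D\<close> commuting with \<i>, so the inequality for
  \<open>D v\<close> is the inequality for \<open>v\<close>.\<close>

lemma invariant_dominates:
  assumes inv: "invariant_kaehler \<omega>" "invariant_kaehler \<omega>'"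
  obtains K where "K \<ge> 0"
    and "\<And>c x v. c \<in> charts M \<Longrightarrow> x \<in> chart_dom c \<Longrightarrow>
      \<omega>' c (chart_map c x) v (\<i> *s v) \<le> K * \<omega> c (chart_map c x) v (\<i> *s v)"
proof (cases "topspace (space_top M) = {}")
  case True
  then show ?thesis
    using that[of 0] chart_dom_subset by fast
next
  case False
  then obtain d y where d: "d \<in> charts M" "y \<in> chart_dom d"
    using chart_exists by blast
  obtain K where K: "K \<ge> 0"
      "\<And>v. \<omega>' d (chart_map d y) v (\<i> *s v) \<le> K * \<omega> d (chart_map d y) v (\<i> *s v)"
    using positive_form.dominates[OF invariant_positive_form[OF inv(1) d]
        positive_form.bilinear[OF invariant_positive_form[OF inv(2) d]]] by blast
  have "\<omega>' c (chart_map c x) v (\<i> *s v) \<le> K * \<omega> c (chart_map c x) v (\<i> *s v)"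
    if c: "c \<in> charts M" "x \<in> chart_dom c" for c x v
  proof -
    obtain D where D: "\<And>v. D (\<i> *s v) = \<i> *s D v"
        "\<And>\<omega> v w. invariant_kaehler \<omega> \<Longrightarrow> \<omega> c (chart_map c x) v w = \<omega> d (chart_map d y) (D v) (D w)"
      using invariant_pullback[OF c(1) d(1) c(2) d(2)] by metis
    then show ?thesis
      using K(2)[of "D v"] by (simp add: D(1) D(2)[OF inv(1)] D(2)[OF inv(2)])
  qed
  then show ?thesis
    using that K(1) by blast
qed

section \<open>Invariant solutions of the flow\<close>

context
  fixes T :: ereal and \<omega>0 :: "('a, 'n) tensor2" and \<omega> :: "real \<Rightarrow> ('a, 'n) tensor2"
  assumes flow: "kaehler_ricci_flow M T \<omega>0 \<omega>"
    and invariant: "t \<in> time_interval T \<Longrightarrow> f \<in> A \<Longrightarrow> preserved_by M f (\<omega> t)"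
begin

lemma zero_in_time_interval: "0 \<in> time_interval T"
  using flow by (simp add: kaehler_ricci_flow_def time_interval_def zero_ereal_def)

lemma flow_invariant_kaehler: "t \<in> time_interval T \<Longrightarrow> invariant_kaehler (\<omega> t)"
  using flow invariant by (simp add: kaehler_ricci_flow_def invariant_kaehler_def)

lemma flow_initial: "\<omega> 0 = \<omega>0"
  using flow by (simp add: kaehler_ricci_flow_def)

text \<open>All the forms \<open>\<omega> s\<close> are invariant, so by
  \<open>ricci_form_unique\<close> the right-hand side of the flow does not change with time and the
  equation integrates explicitly.\<close>

lemma flow_linear:
  assumes t: "t \<in> time_interval T" and c: "c \<in> charts M" and z: "z \<in> chart_image c"
  shows "\<omega> t c z v w = \<omega>0 c z v w - t * ricci_form \<omega>0 c z v w"
proof -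
  let ?I = "time_interval T"
  let ?h = "\<lambda>s. \<omega> s c z v w + s * ricci_form \<omega>0 c z v w"
  \<comment> \<open>The derivative is taken within the interval, one-sided at time 0; on a convex
    set its vanishing still forces constancy.\<close>
  have "convex ?I"
    unfolding is_interval_convex_1[symmetric] is_interval_1 time_interval_def
    by (auto intro: order.strict_trans1[of "ereal _" "ereal _"])
  moreover have "(?h has_field_derivative 0) (at s within ?I)" if s: "s \<in> ?I" for s
  proof -
    have "((\<lambda>s. \<omega> s c z v w) has_real_derivative - ricci_form (\<omega> s) c z v w) (at s within ?I)"
      using flow s c z unfolding kaehler_ricci_flow_def by blast
    moreover have "ricci_form (\<omega> s) c z = ricci_form \<omega>0 c z"
      using ricci_form_unique[OF flow_invariant_kaehler[OF s]
          flow_invariant_kaehler[OF zero_in_time_interval] c z] by (simp add: flow_initial)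
    ultimately show ?thesis
      by (auto intro!: derivative_eq_intros)
  qed
  ultimately obtain k where k: "\<And>s. s \<in> ?I \<Longrightarrow> ?h s = k"
    using has_field_derivative_zero_constant[of ?I ?h] by blast
  show ?thesis
    using k[OF t] k[OF zero_in_time_interval] by (simp add: flow_initial)
qed

lemma finite_time_flow_dominated:
  assumes "T < \<infinity>"
  obtains K where "K \<ge> 0"
    and "\<And>t c x v. t \<in> time_interval T \<Longrightarrow> c \<in> charts M \<Longrightarrow> x \<in> chart_dom c \<Longrightarrow>
      \<omega> t c (chart_map c x) v (\<i> *s v) \<le> K * \<omega>0 c (chart_map c x) v (\<i> *s v)"
proof -
  have "0 < T"
    using flow by (simp add: kaehler_ricci_flow_def)
  then obtain r where r: "T = ereal r" "r > 0"
    using assms by (cases T) auto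
  have I: "s \<in> time_interval T \<longleftrightarrow> 0 \<le> s \<and> s < r" for s
    by (simp add: time_interval_def r(1))
  have inv0: "invariant_kaehler \<omega>0"
    using flow_invariant_kaehler[OF zero_in_time_interval] by (simp add: flow_initial)
  have "r / 2 \<in> time_interval T"
    using r(2) by (simp add: I)
  then obtain K where K: "K \<ge> 0"
      "\<And>c x v. c \<in> charts M \<Longrightarrow> x \<in> chart_dom c \<Longrightarrow>
        \<omega> (r / 2) c (chart_map c x) v (\<i> *s v) \<le> K * \<omega>0 c (chart_map c x) v (\<i> *s v)"
    using invariant_dominates[OF inv0 flow_invariant_kaehler] by metis
  \<comment> \<open>With \<open>a\<close> and \<open>\<rho>\<close> the values of the initial form
    and its Ricci form, time \<open>r / 2\<close> gives
    \<open>a - r / 2 * \<rho> \<le> K * a\<close>, hence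
    \<open>- (r * \<rho>) \<le> 2 * (K * a)\<close>. Since \<open>t < r\<close>, the growth
    \<open>- t * \<rho>\<close> is at most \<open>2 * (K * a)\<close>, which added to
    \<open>a\<close> gives the factor \<open>1 + 2 * K\<close>.\<close>
  have "\<omega> t c (chart_map c x) v (\<i> *s v) \<le> (1 + 2 * K) * \<omega>0 c (chart_map c x) v (\<i> *s v)"
    if t: "t \<in> time_interval T" and c: "c \<in> charts M" and x: "x \<in> chart_dom c" for t c x v
  proof -
    define a where "a = \<omega>0 c (chart_map c x) v (\<i> *s v)"
    define \<rho> where "\<rho> = ricci_form \<omega>0 c (chart_map c x) v (\<i> *s v)"
    have lin: "\<omega> s c (chart_map c x) v (\<i> *s v) = a - s * \<rho>" if "s \<in> time_interval T" for s
      using flow_linear[OF that c, of "chart_map c x"] x by (simp add: a_def \<rho>_def)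
    have "a \<ge> 0"
    proof (cases "v = 0")
      case True
      then show ?thesis
        using positive_form.bilinear[OF invariant_positive_form[OF inv0 c x]]
        by (simp add: a_def bilinear_lzero)
    next
      case False
      then show ?thesis
        using positive_form.positive[OF invariant_positive_form[OF inv0 c x]]
        by (simp add: a_def less_imp_le)
    qed
    have "a - r / 2 * \<rho> \<le> K * a"
      using K(2)[OF c x, of v] lin[OF \<open>r / 2 \<in> time_interval T\<close>] by (simp add: a_def)
    then have "- (r * \<rho>) \<le> 2 * (K * a)"
      using \<open>a \<ge> 0\<close> by linarith
    then have "- \<rho> \<le> 2 * (K * a) / r"
      using r(2) by (simp add: field_simps)
    then have "t * (- \<rho>) \<le> t * (2 * (K * a) / r)"
      using t by (intro mult_left_mono) (simp_all add: I)
    also have "\<dots> \<le> r * (2 * (K * a) / r)"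
      using t r(2) K(1) \<open>a \<ge> 0\<close> by (intro mult_right_mono) (simp_all add: I)
    also have "\<dots> = 2 * (K * a)"
      using r(2) by simp
    finally show ?thesis
      using lin[OF t] by (simp add: a_def[symmetric] algebra_simps)
  qed
  then show ?thesis
    using that[of "1 + 2 * K"] K(1) by simp
qed

text \<open>Curves chosen once for the initial metric serve all times: their squared speed at time
  \<open>t\<close> is at most \<open>K * B\<close>, and the parameter interval has length 1.\<close>

theorem finite_time_diameter_bounded:
  assumes "T < \<infinity>" "connected_space (space_top M)" "compact_space (space_top M)"
  shows "\<exists>C::real. \<forall>t\<in>time_interval T. riemannian_diam M (\<omega> t) \<le> ennreal C"
proof -
  interpret kaehler_manifold M \<omega>0
    using flow_invariant_kaehler[OF zero_in_time_interval]
    by unfold_locales (simp add: flow_initial invariant_kaehler_def)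
  obtain B where B: "\<And>x y. x \<in> topspace (space_top M) \<Longrightarrow> y \<in> topspace (space_top M) \<Longrightarrow> joinable B x y"
    using compact_imp_uniformly_joinable[OF assms(2,3)] by blast
  obtain K where K: "K \<ge> 0"
      "\<And>t c x v. t \<in> time_interval T \<Longrightarrow> c \<in> charts M \<Longrightarrow> x \<in> chart_dom c \<Longrightarrow>
        \<omega> t c (chart_map c x) v (\<i> *s v) \<le> K * \<omega>0 c (chart_map c x) v (\<i> *s v)"
    using finite_time_flow_dominated[OF assms(1)] by blast
  have "riemannian_dist M (\<omega> t) x y \<le> ennreal (sqrt (K * B))"
    if t: "t \<in> time_interval T" and x: "x \<in> topspace (space_top M)" and y: "y \<in> topspace (space_top M)" for t x y
  proof -
    obtain \<gamma> S where \<gamma>: "joining_curve B \<gamma> S" and ends: "\<gamma> 0 = x" "\<gamma> 1 = y"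
      using B[OF x y] unfolding joinable_def by blast
    then have path: "pathin (space_top M) \<gamma>" and "finite S"
      and C1: "\<forall>c\<in>charts M. (chart_map c \<circ> \<gamma>) C1_differentiable_on {t \<in> {0..1} - S. \<gamma> t \<in> chart_dom c}"
      unfolding joining_curve_def by auto
    then have "piecewise_C1_curve M \<gamma>"
      unfolding piecewise_C1_curve_def by blast
    have speed: "speed M (\<omega> t) \<gamma> s \<le> sqrt (K * B)" if s: "s \<in> {0..1} - S" for s
    proof -
      \<comment> \<open>This is the chart that \<open>speed\<close> selects; the bound in
        \<open>joining_curve\<close> holds in every chart around the point, so in this one
        too.\<close>
      define c where "c = (SOME c. c \<in> charts M \<and> \<gamma> s \<in> chart_dom c)"
      have "\<gamma> s \<in> topspace (space_top M)"
        using path_image_subset_topspace[OF path] s by auto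
      then have "\<exists>c. c \<in> charts M \<and> \<gamma> s \<in> chart_dom c"
        using chart_exists by metis
      then have c: "c \<in> charts M" "\<gamma> s \<in> chart_dom c"
        unfolding c_def by (rule someI_ex[THEN conjunct1], rule someI_ex[THEN conjunct2])
      define v where "v = vector_derivative (chart_map c \<circ> \<gamma>) (at s)"
      have "\<omega>0 c (chart_map c (\<gamma> s)) v (\<i> *s v) \<le> B"
        using \<gamma> c s unfolding joining_curve_def Let_def v_def by blast
      then have "\<omega> t c (chart_map c (\<gamma> s)) v (\<i> *s v) \<le> K * B"
        using K(2)[OF t c, of v] mult_left_mono[OF _ K(1)] order_trans by blast
      then show ?thesis
        by (simp add: speed_def Let_def c_def[symmetric] v_def)
    qed
    have "AE s in lborel. s \<notin> S"
      by (rule AE_not_in[OF finite_imp_null_set_lborel[OF \<open>finite S\<close>]])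
    then have "AE s in lborel. ennreal (speed M (\<omega> t) \<gamma> s) * indicator {0..1} s
        \<le> ennreal (sqrt (K * B)) * indicator {0..1} s"
    proof eventually_elim
      fix s :: real assume "s \<notin> S"
      then show "ennreal (speed M (\<omega> t) \<gamma> s) * indicator {0..1} s
          \<le> ennreal (sqrt (K * B)) * indicator {0..1} s"
        using speed[of s] by (auto simp: indicator_def intro: ennreal_leI)
    qed
    then have "curve_length M (\<omega> t) \<gamma> \<le> (\<integral>\<^sup>+ s \<in> {0..1::real}. ennreal (sqrt (K * B)) \<partial>lborel)"
      unfolding curve_length_def by (rule nn_integral_mono_AE)
    also have "\<dots> = ennreal (sqrt (K * B))"
      by (simp add: nn_integral_cmult_indicator)
    finally show ?thesis
      unfolding riemannian_dist_def using \<open>piecewise_C1_curve M \<gamma>\<close> ends by (intro INF_lower2[of \<gamma>]) auto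
  qed
  then have "\<forall>t\<in>time_interval T. riemannian_diam M (\<omega> t) \<le> ennreal (sqrt (K * B))"
    unfolding riemannian_diam_def by (intro ballI SUP_least)
  then show ?thesis
    by blast
qed

end

end

section \<open>Rational homogeneous varieties\<close>

text \<open>Near \<open>x\<close> the translation factors as a local holomorphic section into the
  group, left multiplication by \<open>a\<close>, and the projection to cosets; the chain rule does
  the rest.\<close>

lemma translation_differentiable:
  fixes GC :: "'g monoid" and M :: "('g, 'm::finite) cmanifold" and X :: "('g set, 'n::finite) cmanifold"
  assumes lie: "complex_lie_group GC M" and P: "subgroup P GC"
    and quot: "quotient_complex_manifold GC M P X" and a: "a \<in> carrier GC"
    and c: "c \<in> charts X" "x \<in> chart_dom c" and d: "d \<in> charts X" "a <#\<^bsub>GC\<^esub> x \<in> chart_dom d"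
  shows "complex_differentiable_at (\<lambda>v. \<i> *s v) (local_rep c d (\<lambda>x. a <#\<^bsub>GC\<^esub> x)) (chart_map c x)"
proof -
  interpret GC: group GC
    using lie by (simp add: complex_lie_group_def)
  interpret M: complex_manifold_space M
    by unfold_locales (use lie in \<open>simp add: complex_lie_group_def\<close>)
  interpret X: complex_manifold_space X
    by unfold_locales (use quot in \<open>simp add: quotient_complex_manifold_def\<close>)
  have top: "topspace (space_top M) = carrier GC"
    using lie by (simp add: complex_lie_group_def)
  have "x \<in> topspace (space_top X)"
    using X.chart_dom_subset c by blast
  then have "\<exists>V s. x \<in> V \<and> holomorphic_map_on X M V s \<and> (\<forall>y\<in>V. s y <#\<^bsub>GC\<^esub> P = y)"
    using quot unfolding quotient_complex_manifold_def by blast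
  then obtain V s where V: "x \<in> V" and s: "holomorphic_map_on X M V s"
    and s_section: "\<And>y. y \<in> V \<Longrightarrow> s y <#\<^bsub>GC\<^esub> P = y"
    by blast
  have "openin (space_top X) V"
    and s_cont: "continuous_map (subtopology (space_top X) V) (space_top M) s"
    using s by (auto simp: holomorphic_map_on_def)
  have V_top: "topspace (subtopology (space_top X) V) = V"
    using openin_subset[OF \<open>openin (space_top X) V\<close>] by (simp add: Int_absorb1)
  have s_carrier: "s y \<in> carrier GC" if "y \<in> V" for y
    using continuous_map_image_subset_topspace[OF s_cont] that
    unfolding V_top top by blast
  have translate: "a <#\<^bsub>GC\<^esub> y = (a \<otimes>\<^bsub>GC\<^esub> s y) <#\<^bsub>GC\<^esub> P" if "y \<in> V" for y
    using GC.lcos_m_assoc[OF subgroup.subset[OF P] a s_carrier[OF that]] s_section[OF that] by simp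
  obtain e0 where e0: "e0 \<in> charts M" "a \<in> chart_dom e0"
    using M.chart_exists a top by blast
  obtain e where e: "e \<in> charts M" "s x \<in> chart_dom e"
    using M.chart_exists s_carrier[OF V] top by blast
  obtain e' where e': "e' \<in> charts M" "a \<otimes>\<^bsub>GC\<^esub> s x \<in> chart_dom e'"
    using M.chart_exists a s_carrier[OF V] top by (metis GC.m_closed)
  define F where "F = (\<lambda>(z, w). chart_map e' (chart_inv e0 z \<otimes>\<^bsub>GC\<^esub> chart_inv e w))"
  have mult: "complex_differentiable_at (\<lambda>v. \<i> *s v) (\<lambda>w. F (chart_map e0 a, w)) (chart_map e (s x))"
  proof (rule complex_differentiable_at_slice)
    show "complex_differentiable_at (\<lambda>(v, w). (\<i> *s v, \<i> *s w)) F (chart_map e0 a, chart_map e (s x))"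
      using lie e0 e e' unfolding complex_lie_group_def F_def by blast
  qed
  have sec: "complex_differentiable_at (\<lambda>v. \<i> *s v) (local_rep c e s) (chart_map c x)"
    using s c e V unfolding holomorphic_map_on_def by blast
  have sec_x: "local_rep c e s (chart_map c x) = chart_map e (s x)"
    by (simp add: local_rep_def X.chart_inv_chart_map[OF c])
  have F_x: "F (chart_map e0 a, chart_map e (s x)) = chart_map e' (a \<otimes>\<^bsub>GC\<^esub> s x)"
    by (simp add: F_def M.chart_inv_chart_map[OF e0] M.chart_inv_chart_map[OF e])
  have proj: "complex_differentiable_at (\<lambda>v. \<i> *s v) (local_rep e' d (\<lambda>g. g <#\<^bsub>GC\<^esub> P))
      (chart_map e' (a \<otimes>\<^bsub>GC\<^esub> s x))"
  proof -
    have "a \<otimes>\<^bsub>GC\<^esub> s x \<in> carrier GC \<inter> chart_dom e'"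
      using e'(2) a s_carrier[OF V] by simp
    moreover have "(a \<otimes>\<^bsub>GC\<^esub> s x) <#\<^bsub>GC\<^esub> P \<in> chart_dom d"
      using d(2) translate[OF V] by simp
    ultimately show ?thesis
      using quot e'(1) d(1) unfolding quotient_complex_manifold_def holomorphic_map_on_def by blast
  qed
  let ?h = "\<lambda>z. local_rep e' d (\<lambda>g. g <#\<^bsub>GC\<^esub> P) (F (chart_map e0 a, local_rep c e s z))"
  have "complex_differentiable_at (\<lambda>v. \<i> *s v) (\<lambda>z. F (chart_map e0 a, local_rep c e s z)) (chart_map c x)"
    using complex_differentiable_at_compose[OF sec, of "\<lambda>w. F (chart_map e0 a, w)"] mult
    by (simp only: sec_x)
  then have h: "complex_differentiable_at (\<lambda>v. \<i> *s v) ?h (chart_map c x)"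
    by (rule complex_differentiable_at_compose) (simp only: sec_x F_x proj)
  have mult_cont: "continuous_map (space_top M) (space_top M) (\<lambda>g. a \<otimes>\<^bsub>GC\<^esub> g)"
  proof -
    have "continuous_map (space_top M) (prod_topology (space_top M) (space_top M)) (\<lambda>g. (a, g))"
      using a by (simp add: continuous_map_pairedI top)
    moreover have "continuous_map (prod_topology (space_top M) (space_top M)) (space_top M)
        (\<lambda>(a, b). a \<otimes>\<^bsub>GC\<^esub> b)"
      using lie by (simp add: complex_lie_group_def)
    ultimately show ?thesis
      using continuous_map_compose[of _ _ "\<lambda>g. (a, g)"] by (fastforce simp: o_def)
  qed
  \<comment> \<open>On \<open>U\<close> the section and its translate stay in the charts
    \<open>e\<close> and \<open>e'\<close>, so the chart inverses cancel and the composite really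
    represents the translation.\<close>
  define U where "U = {y \<in> V. s y \<in> chart_dom e} \<inter> {y \<in> V. a \<otimes>\<^bsub>GC\<^esub> s y \<in> chart_dom e'} \<inter> chart_dom c"
  have "openin (space_top X) {y \<in> V. s y \<in> chart_dom e}"
    using openin_continuous_map_preimage[OF s_cont M.chart_dom_openin[OF e(1)]]
      openin_trans_full[OF _ \<open>openin (space_top X) V\<close>] by (simp only: V_top)
  moreover have "openin (space_top X) {y \<in> V. a \<otimes>\<^bsub>GC\<^esub> s y \<in> chart_dom e'}"
    using openin_continuous_map_preimage[OF continuous_map_compose[OF s_cont mult_cont] M.chart_dom_openin[OF e'(1)]]
      openin_trans_full[OF _ \<open>openin (space_top X) V\<close>] by (simp only: V_top o_def)
  ultimately have "openin (space_top X) U"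
    unfolding U_def using X.chart_dom_openin[OF c(1)] by (intro openin_Int)
  then have "open (chart_map c ` U)"
    by (rule X.open_chart_map_image[OF c(1)]) (simp add: U_def)
  moreover have "chart_map c x \<in> chart_map c ` U"
    using V e e' c by (intro imageI) (simp add: U_def)
  moreover have "?h z = local_rep c d (\<lambda>x. a <#\<^bsub>GC\<^esub> x) z" if z: "z \<in> chart_map c ` U" for z
  proof -
    obtain y where y: "y \<in> U" "z = chart_map c y"
      using z by blast
    then have "chart_inv c z = y" "y \<in> V" "s y \<in> chart_dom e" "a \<otimes>\<^bsub>GC\<^esub> s y \<in> chart_dom e'"
      using X.chart_inv_chart_map[OF c(1), of y] by (auto simp: U_def)
    then show ?thesis
      by (simp add: local_rep_def F_def translate M.chart_inv_chart_map[OF e0]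
          M.chart_inv_chart_map[OF e(1)] M.chart_inv_chart_map[OF e'(1)])
  qed
  ultimately show ?thesis
    using complex_differentiable_at_transform[OF h] by blast
qed

text \<open>The left translations by \<open>G\<close> make \<open>X\<close> a homogeneous manifold.
  Connectedness descends from the complex group, whereas compactness comes from the compact group
  \<open>G\<close>.\<close>

theorem corollary1:
  fixes GC :: "'g monoid"
    and M :: "('g, 'm::finite) cmanifold"
    and P G :: "'g set"
    and X :: "('g set, 'n::finite) cmanifold"
    and T :: ereal
    and \<omega>0 :: "('g set, 'n) tensor2"
    and \<omega> :: "real \<Rightarrow> ('g set, 'n) tensor2"
  assumes simple: "simple_complex_lie_group GC M"
    and simply_connected: "simply_connected_space (space_top M)"
    and parabolic: "parabolic_subgroup GC M P"
    and real_form: "compact_real_form GC M G"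
    and quotient: "quotient_complex_manifold GC M P X"
    and homogeneous_space:
      "\<forall>x\<in>topspace (space_top X). \<forall>y\<in>topspace (space_top X). \<exists>a\<in>G. a <#\<^bsub>GC\<^esub> x = y"
    and flow: "maximal_kaehler_ricci_flow X T \<omega>0 \<omega>"
    and homogeneous: "\<forall>t\<in>time_interval T. \<forall>a\<in>G. preserved_by X (\<lambda>x. a <#\<^bsub>GC\<^esub> x) (\<omega> t)"
    and finite_time: "T < \<infinity>"
  shows "\<exists>C::real. \<forall>t\<in>time_interval T. riemannian_diam X (\<omega> t) \<le> ennreal C"
proof -
  have lie: "complex_lie_group GC M"
    using simple by (simp add: simple_complex_lie_group_def)
  have P: "subgroup P GC"
    using parabolic by (simp add: parabolic_subgroup_def)
  have G: "subgroup G GC" "compactin (space_top M) G"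
    using real_form by (simp_all add: compact_real_form_def)
  interpret GC: group GC
    using lie by (simp add: complex_lie_group_def)
  interpret homogeneous_manifold X "(\<lambda>a x. a <#\<^bsub>GC\<^esub> x) ` G"
  proof
    show "complex_manifold X"
      using quotient by (simp add: quotient_complex_manifold_def)
    show "complex_differentiable_at (\<lambda>v. \<i> *s v) (local_rep c d f) (chart_map c x)"
      if "f \<in> (\<lambda>a x. a <#\<^bsub>GC\<^esub> x) ` G" "c \<in> charts X" "d \<in> charts X" "x \<in> chart_dom c" "f x \<in> chart_dom d"
      for f c d x
      using that translation_differentiable[OF lie P quotient] subgroup.mem_carrier[OF G(1)] by blast
    show "\<exists>f\<in>(\<lambda>a x. a <#\<^bsub>GC\<^esub> x) ` G. f x = y"
      if "x \<in> topspace (space_top X)" "y \<in> topspace (space_top X)" for x y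
      using homogeneous_space that by blast
  qed
  have proj: "quotient_map (space_top M) (space_top X) (\<lambda>a. a <#\<^bsub>GC\<^esub> P)"
    using quotient by (simp add: quotient_complex_manifold_def)
  have "connected_space (space_top X)"
    using connected_space_quotient_map_image[OF proj] simple by (simp add: simple_complex_lie_group_def)
  moreover have "compact_space (space_top X)"
  proof -
    have top: "topspace (space_top X) = lcosets\<^bsub>GC\<^esub> P"
      using quotient by (simp add: quotient_complex_manifold_def)
    have base: "\<one>\<^bsub>GC\<^esub> <#\<^bsub>GC\<^esub> P = P"
      by (rule GC.lcos_mult_one[OF subgroup.subset[OF P]])
    then have "P \<in> topspace (space_top X)"
      unfolding top LCOSETS_def by (auto intro: bexI[of _ "\<one>\<^bsub>GC\<^esub>"])
    \<comment> \<open>Transitivity at the base coset \<open>P\<close> presents \<open>X\<close> as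
      the continuous image of the compact set \<open>G\<close> under the projection.\<close>
    then have "\<forall>y\<in>topspace (space_top X). \<exists>a\<in>G. a <#\<^bsub>GC\<^esub> P = y"
      using homogeneous_space by (rule bspec[rotated])
    then have "topspace (space_top X) \<subseteq> (\<lambda>a. a <#\<^bsub>GC\<^esub> P) ` G"
      by auto
    moreover have "compactin (space_top X) ((\<lambda>a. a <#\<^bsub>GC\<^esub> P) ` G)"
      by (rule image_compactin[OF G(2) quotient_imp_continuous_map[OF proj]])
    ultimately show ?thesis
      unfolding compact_space_def using compactin_subset_topspace[of "space_top X"] subset_antisym by metis
  qed
  moreover have "kaehler_ricci_flow X T \<omega>0 \<omega>"
    using flow by (simp add: maximal_kaehler_ricci_flow_def)
  ultimately show ?thesis
    using finite_time_diameter_bounded[of T \<omega>0 \<omega>] homogeneous finite_time by blast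
qed

end
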